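(* (i) Let $G$ be a matrix Lie group with a matrix Lie algebra $\mathfrak{g}$ such that $\exp:\mathfrak{g}\to G$ is bijective. Then a map $\mathfrak{B}:G\to G$ is a Rota-Baxter operator with limit-weight zero if and only if $$\mathfrak{B}(\exp(u))\,\mathfrak{B}(\exp(v))=\mathfrak{B}\Big(\exp\big(u+\mathfrak{B}(\exp(u))\,v\,\mathfrak{B}(\exp(u))^{-1}\big)\Big),\quad u,v\in\mathfrak{g}.$$ (ii) Let $\mathfrak{J}$ be the set of smooth maps $\mathbb{R}\to\{(a_{ij})\in\mathbb{C}^{3\times3}\mid a_{ij}=0\text{ for }i\ge j\}$. Then a map $\mathfrak{B}^{\mathfrak{J}}:\exp(\mathfrak{J})\to\exp(\mathfrak{J})$ is a Rota-Baxter operator with limit-weight zero if and only if $$\mathfrak{B}^{\mathfrak{J}}(\exp(u))\,\mathfrak{B}^{\mathfrak{J}}(\exp(v))=\mathfrak{B}^{\mathfrak{J}}\Big(\exp\big(u+\mathfrak{B}^{\mathfrak{J}}(\exp(u))\,v\,\mathfrak{B}^{\mathfrak{J}}(\exp(u))^{-1}\big)\Big),\quad u,v\in\mathfrak{J}.$$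
   Context: A topological group $G$ is a $\mathbb{Q}$-group if for each nonzero integer $n$ the map $P_n:a\mapsto a^n$ is bijective (write $a^{1/n}:=P_n^{-1}(a)$) and $\lim_{n\to\infty}a^{1/n}$ uniquely exists and equals $e$ for each $a\in G$. It is a $\lim_{n\to\infty}(P_n^{-1},P_n)$-group if $\lim_{n\to\infty}(a^{1/n}b^{1/n})^n$ uniquely exists for all $a,b\in G$ and, for all sequences $a_n\to a$, $b_n\to b$, $\lim_n(a_n^{1/n}b_n^{1/n})^n=\lim_n(a^{1/n}b^{1/n})^n$. For $G$ a $\mathbb{Q}$-group which is also a $\lim_{n\to\infty}(P_n^{-1},P_n)$-group, a map $\mathfrak{B}:G\to G$ is a Rota-Baxter operator with limit-weight zero (also called weight zero) if for all $a,b\in G$ the limit $\lim_{n\to\infty}\big(a^{1/n}\mathfrak{B}(a)b^{1/n}\mathfrak{B}(a)^{-1}\big)^n$ uniquely exists and $$\mathfrak{B}(a)\mathfrak{B}(b)=\mathfrak{B}\Big(\lim_{n\to\infty}\big(a^{1/n}\mathfrak{B}(a)b^{1/n}\mathfrak{B}(a)^{-1}\big)^n\Big).$$ $\exp$ is the matrix exponential. $\exp(\mathfrak{J})=\{\exp(u)\mid u\in\mathfrak{J}\}$, with $\exp(u)(x):=\exp(u(x))$, is a group under pointwise matrix multiplication, with the topology of pointwise convergence; here $\exp(u)^{r}=\exp(ru)$. Products such as $\mathfrak{B}(\exp(u))\,v\,\mathfrak{B}(\exp(u))^{-1}$ are matrix products (pointwise in the case of $\mathfrak{J}$). *)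

theory Defs
  imports "HOL-Analysis.Analysis" "HOL-Algebra.Group"
begin

section \<open>Topological groups and limit conditions\<close>

locale topological_group = group G for G :: "('a, 'b) monoid_scheme" (structure) +
  fixes T :: "'a topology"
  assumes topspace_eq: "topspace T = carrier G"
    and continuous_mult: "continuous_map (prod_topology T T) T (\<lambda>(x, y). x \<otimes> y)"
    and continuous_inv: "continuous_map T T (\<lambda>x. inv x)"

definition unique_limit :: "'a topology \<Rightarrow> (nat \<Rightarrow> 'a) \<Rightarrow> 'a \<Rightarrow> bool" where
  "unique_limit T X l \<longleftrightarrow>
     limitin T X l sequentially \<and> (\<forall>l'. limitin T X l' sequentially \<longrightarrow> l' = l)"

text \<open>\<open>group_root G n a\<close> is $a^{1/n} = P_n^{-1}(a)$; it is meaningful when \<open>n \<noteq> 0\<close> and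
  $P_n$ is a bijection of the carrier. In the limits below the junk value at \<open>n = 0\<close> is irrelevant.\<close>

definition group_root :: "('a, 'b) monoid_scheme \<Rightarrow> int \<Rightarrow> 'a \<Rightarrow> 'a" where
  "group_root G n = inv_into (carrier G) (\<lambda>x. x [^]\<^bsub>G\<^esub> n)"

locale Q_group = topological_group +
  assumes bij_betw_power: "\<And>n :: int. n \<noteq> 0 \<Longrightarrow> bij_betw (\<lambda>x. x [^] n) (carrier G) (carrier G)"
    and root_limit: "\<And>a. a \<in> carrier G \<Longrightarrow> unique_limit T (\<lambda>n. group_root G (int n) a) \<one>"

text \<open>A $\mathbb{Q}$-group that is also a $\lim_{n\to\infty}(P_n^{-1},P_n)$-group.\<close>

locale lim_Q_group = Q_group +
  assumes lim_product:
    "\<And>a b. \<lbrakk>a \<in> carrier G; b \<in> carrier G\<rbrakk> \<Longrightarrow>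
       \<exists>l. unique_limit T
             (\<lambda>n. (group_root G (int n) a \<otimes> group_root G (int n) b) [^] n) l \<and>
           (\<forall>a' b'. (\<forall>n. a' n \<in> carrier G) \<and> (\<forall>n. b' n \<in> carrier G) \<and>
                limitin T a' a sequentially \<and> limitin T b' b sequentially \<longrightarrow>
              unique_limit T
                (\<lambda>n. (group_root G (int n) (a' n) \<otimes> group_root G (int n) (b' n)) [^] n) l)"

locale limit_weight_zero_Rota_Baxter = lim_Q_group +
  fixes B :: "'a \<Rightarrow> 'a"
  assumes maps: "B \<in> carrier G \<rightarrow> carrier G"
    and Rota_Baxter:
    "\<And>a b. \<lbrakk>a \<in> carrier G; b \<in> carrier G\<rbrakk> \<Longrightarrow>
       \<exists>l. unique_limit T
             (\<lambda>n. (group_root G (int n) a \<otimes> B a \<otimes> group_root G (int n) b \<otimes> inv (B a)) [^] n) l \<and>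
           B a \<otimes> B b = B l"


section \<open>Matrix exponential, matrix Lie groups and their Lie algebras\<close>

primrec matrix_power :: "complex^'n^'n \<Rightarrow> nat \<Rightarrow> complex^'n^'n" where
  "matrix_power A 0 = mat 1"
| "matrix_power A (Suc k) = A ** matrix_power A k"

definition matrix_exp :: "complex^'n^'n \<Rightarrow> complex^'n^'n" where
  "matrix_exp A = (\<Sum>k. (1 / fact k) *\<^sub>R matrix_power A k)"

definition GL :: "(complex^'n^'n) monoid" where
  "GL = \<lparr>carrier = {A. invertible A}, monoid.mult = (**), one = mat 1\<rparr>"

text \<open>A matrix Lie group is a subgroup of $GL_n(\mathbb{C})$ that is closed in
  $GL_n(\mathbb{C})$ (not necessarily in the space of all matrices). Real matrix groups are
  included, since $GL_n(\mathbb{R})$ is closed in $GL_n(\mathbb{C})$.\<close>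

definition matrix_Lie_group :: "(complex^'n^'n) set \<Rightarrow> bool" where
  "matrix_Lie_group G \<longleftrightarrow>
     subgroup G GL \<and> closedin (top_of_set (carrier GL)) G"

definition matrix_Lie_algebra :: "(complex^'n^'n) set \<Rightarrow> (complex^'n^'n) set" where
  "matrix_Lie_algebra G = {X. \<forall>t :: real. matrix_exp (t *\<^sub>R X) \<in> G}"


section \<open>Smooth maps into the strictly upper triangular matrices\<close>

definition smooth :: "(real \<Rightarrow> 'a :: real_normed_vector) \<Rightarrow> bool" where
  "smooth f \<longleftrightarrow>
     (\<exists>D :: nat \<Rightarrow> real \<Rightarrow> 'a. D 0 = f \<and>
        (\<forall>k t. (D k has_vector_derivative D (Suc k) t) (at t)))"

text \<open>The condition $a_{ij} = 0$ for $i \ge j$ is written out for the indices 1, 2, 3, because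
  in the library's order on the index type \<open>3\<close> the numeral \<open>3\<close> equals \<open>0\<close> and is the least element.\<close>

definition strictly_upper_triangular :: "(complex^3^3) set" where
  "strictly_upper_triangular =
     {A. A$1$1 = 0 \<and> A$2$1 = 0 \<and> A$2$2 = 0 \<and> A$3$1 = 0 \<and> A$3$2 = 0 \<and> A$3$3 = 0}"

definition J_maps :: "(real \<Rightarrow> complex^3^3) set" where
  "J_maps = {u. smooth u \<and> range u \<subseteq> strictly_upper_triangular}"

definition pointwise_exp :: "(real \<Rightarrow> complex^'n^'n) \<Rightarrow> real \<Rightarrow> complex^'n^'n" where
  "pointwise_exp u = (\<lambda>x. matrix_exp (u x))"

definition exp_J :: "(real \<Rightarrow> complex^3^3) monoid" where
  "exp_J = \<lparr>carrier = pointwise_exp ` J_maps, monoid.mult = (\<lambda>f g x. f x ** g x),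
            one = (\<lambda>x. mat 1)\<rparr>"

definition pointwise_topology :: "(real \<Rightarrow> complex^3^3) topology" where
  "pointwise_topology =
     subtopology (product_topology (\<lambda>_. euclidean) UNIV) (carrier exp_J)"

end

theory Submission
  imports Defs
begin

text \<open>
  Both groups are parametrized by an exponential map, so that the root \<open>a\<^sup>1\<^sup>/\<^sup>n\<close> of
  \<open>a = exp u\<close> is \<open>exp (u/n)\<close>. For \<open>b = exp v\<close> and \<open>g = B(a)\<close> one has
  \<open>g b\<^sup>1\<^sup>/\<^sup>n g\<^sup>-\<^sup>1 = exp (w/n)\<close> with \<open>w = g v g\<^sup>-\<^sup>1\<close>, and the Lie product formula
  \<open>(exp (u/n) exp (w/n))\<^sup>n \<longrightarrow> exp (u + w)\<close> evaluates the limit in the definition of a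
  Rota-Baxter operator. The operator identity thereby becomes the stated one, and it ranges over
  the same pairs because \<open>exp\<close> is onto. The locale \<open>exponential_group\<close> carries out this
  argument once for both groups.

  What takes work is that the two groups satisfy the topological hypotheses, which are part of the
  definition of a Rota-Baxter operator. The decisive one asks that
  \<open>(a\<^sub>n\<^sup>1\<^sup>/\<^sup>n b\<^sub>n\<^sup>1\<^sup>/\<^sup>n)\<^sup>n\<close> has the same limit for all sequences
  \<open>a\<^sub>n \<longrightarrow> a\<close>, \<open>b\<^sub>n \<longrightarrow> b\<close>. The Lie product formula, in the version with
  variable arguments (\<open>Lie_product_formula\<close>), yields this once the logarithm
  \<open>exp\<^sup>-\<^sup>1\<close> is known to be continuous.

  For the matrix Lie group only bijectivity of \<open>exp\<close> is given, and continuity of the logarithm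
  is a global statement. It follows from a topological fact about homogeneous spaces
  (\<open>homogeneous_image_homeomorphism\<close>): by Baire's theorem the logarithm is continuous near
  some point of the group, translations compare every point with this one, and invariance of domain
  shows that \<open>exp\<close> is open everywhere. That the Lie algebra is a linear
  subspace is another application of the Lie product formula.

  For strictly upper triangular matrices of size three, exponential and logarithm are quadratic
  polynomials. Continuity of the logarithm, the product formula
  \<open>exp u exp v = exp (u + v + [u,v]/2)\<close> and smoothness are then pointwise computations.
\<close>

section \<open>The exponential in a Banach algebra\<close>

text \<open>Uniform convergence of the exponential series on balls, by the Weierstrass test; no
  commutativity is assumed.\<close>
lemma continuous_on_exp_Banach_algebra:
  "continuous_on UNIV (exp :: 'a \<Rightarrow> 'a::{real_normed_algebra_1,banach})"
proof -
  have ball: "continuous_on (ball 0 r) (exp :: 'a \<Rightarrow> 'a)" for r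
  proof (rule uniform_limit_theorem)
    show "\<forall>\<^sub>F n in sequentially. continuous_on (ball 0 r) (\<lambda>x::'a. \<Sum>i<n. x ^ i /\<^sub>R fact i)"
      by (intro always_eventually allI continuous_intros)
    have "summable (\<lambda>n. r ^ n /\<^sub>R fact n)"
      by (rule summable_exp_generic)
    then show "uniform_limit (ball 0 r) (\<lambda>n x::'a. \<Sum>i<n. x ^ i /\<^sub>R fact i) exp sequentially"
      unfolding exp_def
    proof (rule Weierstrass_m_test[rotated])
      fix n and x :: 'a
      assume "x \<in> ball 0 r"
      then have "norm x ^ n \<le> r ^ n"
        by (intro power_mono) auto
      then have "norm (x ^ n) \<le> r ^ n"
        using norm_power_ineq order_trans by blast
      then show "norm (x ^ n /\<^sub>R fact n) \<le> r ^ n /\<^sub>R fact n"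
        by (simp add: mult_left_mono)
    qed
  qed simp
  show ?thesis
  proof (clarsimp simp: continuous_on_eq_continuous_at)
    fix x :: 'a
    show "isCont exp x"
      using ball[of "norm x + 1"] by (simp add: continuous_on_eq_continuous_at)
  qed
qed

lemma tendsto_exp_Banach_algebra:
  fixes f :: "_ \<Rightarrow> 'a::{real_normed_algebra_1,banach}"
  assumes "(f \<longlongrightarrow> x) F"
  shows "((\<lambda>n. exp (f n)) \<longlongrightarrow> exp x) F"
  using continuous_on_tendsto_compose[OF continuous_on_exp_Banach_algebra assms] by simp

lemma norm_exp_minus_linear_le:
  fixes x :: "'a::{real_normed_algebra_1,banach}"
  assumes "norm x \<le> 1"
  shows "norm (exp x - 1 - x) \<le> (norm x)\<^sup>2"
proof -
  let ?a = "\<lambda>n. inverse (fact (n + 2)) *\<^sub>R x ^ (n + 2)"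
  let ?b = "\<lambda>n. inverse (fact (n + 2)) *\<^sub>R norm x ^ (n + 2)"
  have le: "norm (?a n) \<le> ?b n" for n
    by (simp add: norm_power_ineq mult_left_mono del: power_Suc)
  have sb: "summable ?b"
    using summable_ignore_initial_segment[OF summable_exp_generic[of "norm x"], of 2] by simp
  have "norm (exp x - 1 - x) = norm (suminf ?a)"
    by (simp add: exp_first_two_terms)
  also have "\<dots> \<le> (\<Sum>n. norm (?a n))"
    by (rule summable_norm, rule summable_comparison_test'[OF sb, of 0]) (use le in simp)
  also have "\<dots> \<le> suminf ?b"
    by (rule suminf_le[OF le _ sb], rule summable_comparison_test'[OF sb, of 0]) (use le in simp)
  also have "\<dots> = exp (norm x) - 1 - norm x"
    by (simp add: exp_first_two_terms)
  also have "\<dots> \<le> (norm x)\<^sup>2"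
    using exp_bound[of "norm x"] assms by simp
  finally show ?thesis .
qed

lemma exp_scaleR_of_nat:
  fixes x :: "'a::{real_normed_algebra_1,banach}"
  shows "exp (real n *\<^sub>R x) = exp x ^ n"
proof (induction n)
  case (Suc n)
  have "exp (real (Suc n) *\<^sub>R x) = exp (x + real n *\<^sub>R x)"
    by (simp add: algebra_simps)
  then show ?case
    using Suc by (simp add: exp_add_commuting)
qed simp

lemma norm_power_diff_le:
  fixes x y :: "'a::real_normed_algebra_1"
  assumes "norm x \<le> M" "norm y \<le> M" "1 \<le> M"
  shows "norm (x ^ n - y ^ n) \<le> real n * M ^ n * norm (x - y)"
proof (induction n)
  case (Suc n)
  have y: "norm (y ^ n) \<le> M ^ Suc n"
  proof -
    have "norm (y ^ n) \<le> norm y ^ n"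
      by (rule norm_power_ineq)
    also have "\<dots> \<le> M ^ n"
      using assms by (intro power_mono) auto
    also have "\<dots> \<le> M ^ Suc n"
      using assms by (intro power_increasing) auto
    finally show ?thesis .
  qed
  have "x ^ Suc n - y ^ Suc n = x * (x ^ n - y ^ n) + (x - y) * y ^ n"
    by (simp add: algebra_simps)
  then have "norm (x ^ Suc n - y ^ Suc n)
      \<le> norm x * norm (x ^ n - y ^ n) + norm (x - y) * norm (y ^ n)"
    by (simp only:) (intro norm_triangle_le add_mono norm_mult_ineq)
  also have "\<dots> \<le> M * (real n * M ^ n * norm (x - y)) + norm (x - y) * M ^ Suc n"
    using assms Suc y by (intro add_mono mult_mono) auto
  also have "\<dots> = real (Suc n) * M ^ Suc n * norm (x - y)"
    by (simp add: algebra_simps)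
  finally show ?case .
qed simp

text \<open>The derivative of \<open>exp\<close> at \<open>0\<close> is the identity; the form with a moving argument
  \<open>u n\<close> is what makes the product formula uniform in its arguments.\<close>
lemma scaled_exp_minus_one_tendsto:
  fixes u :: "nat \<Rightarrow> 'a::{real_normed_algebra_1,banach}"
  assumes "u \<longlonglongrightarrow> w"
  shows "(\<lambda>n. real n *\<^sub>R (exp ((1 / real n) *\<^sub>R u n) - 1)) \<longlonglongrightarrow> w"
proof -
  have u_n: "(\<lambda>n. (1 / real n) *\<^sub>R u n) \<longlonglongrightarrow> 0"
    using tendsto_scaleR[OF lim_1_over_n assms] by simp
  then have small: "\<forall>\<^sub>F n in sequentially. norm ((1 / real n) *\<^sub>R u n) < 1"
    using order_tendstoD(2)[OF tendsto_norm, OF u_n, of 1] by (simp only: norm_zero zero_less_one)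
  have "\<forall>\<^sub>F n in sequentially. norm (real n *\<^sub>R (exp ((1 / real n) *\<^sub>R u n) - 1) - u n)
      \<le> norm ((1 / real n) *\<^sub>R u n) * norm (u n)"
    using small eventually_gt_at_top[of 0]
  proof eventually_elim
    case (elim n)
    let ?x = "(1 / real n) *\<^sub>R u n"
    have u: "u n = real n *\<^sub>R ?x"
      using elim by simp
    have "real n *\<^sub>R (exp ?x - 1) - u n = real n *\<^sub>R (exp ?x - 1 - ?x)"
      by (subst (2) u) (simp add: scaleR_diff_right)
    then have "norm (real n *\<^sub>R (exp ?x - 1) - u n) = real n * norm (exp ?x - 1 - ?x)"
      by simp
    also have "\<dots> \<le> real n * (norm ?x)\<^sup>2"
      using elim by (intro mult_left_mono norm_exp_minus_linear_le) auto
    also have "\<dots> = norm ?x * norm (u n)"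
      by (subst (2) u) (simp add: power2_eq_square)
    finally show ?case .
  qed
  moreover have "(\<lambda>n. norm ((1 / real n) *\<^sub>R u n) * norm (u n)) \<longlonglongrightarrow> 0"
    using tendsto_mult[OF tendsto_norm[OF u_n] tendsto_norm[OF assms]] by simp
  ultimately have "(\<lambda>n. real n *\<^sub>R (exp ((1 / real n) *\<^sub>R u n) - 1) - u n) \<longlonglongrightarrow> 0"
    by (rule Lim_null_comparison)
  from tendsto_add[OF this assms] show ?thesis
    by simp
qed

text \<open>Euler's limit \<open>(1 + w/n)\<^sup>n \<longrightarrow> exp w\<close> in a noncommutative setting. Both \<open>A n\<close> and
  \<open>exp (w/n)\<close> have norm at most \<open>1 + C/n\<close>, so their \<open>n\<close>-th powers differ by at most
  \<open>exp C\<close> times \<open>n\<close> times their own distance, which is \<open>o(1/n)\<close>.\<close>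

lemma power_tendsto_exp:
  fixes A :: "nat \<Rightarrow> 'a::{real_normed_algebra_1,banach}"
  assumes "(\<lambda>n. real n *\<^sub>R (A n - 1)) \<longlonglongrightarrow> w"
  shows "(\<lambda>n. A n ^ n) \<longlonglongrightarrow> exp w"
proof -
  define y where "y n = exp ((1 / real n) *\<^sub>R w)" for n
  have y: "(\<lambda>n. real n *\<^sub>R (y n - 1)) \<longlonglongrightarrow> w"
    unfolding y_def by (rule scaled_exp_minus_one_tendsto) simp
  obtain C1 C2 where C1: "\<And>n. norm (real n *\<^sub>R (A n - 1)) \<le> C1"
    and C2: "\<And>n. norm (real n *\<^sub>R (y n - 1)) \<le> C2"
    using convergent_imp_Bseq[OF convergentI[OF assms]] convergent_imp_Bseq[OF convergentI[OF y]]
    unfolding Bseq_def by blast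
  define C where "C = max C1 C2"
  have C0: "0 \<le> C"
    using C1[of 0] by (simp add: C_def)
  have M: "norm z \<le> 1 + C / real n" if "norm (real n *\<^sub>R (z - 1)) \<le> C" "n > 0" for z :: 'a and n
  proof -
    have "norm z \<le> 1 + norm (z - 1)"
      using norm_triangle_ineq[of 1 "z - 1"] by simp
    moreover have "norm (z - 1) \<le> C / real n"
      using that by (simp only: norm_scaleR abs_of_nat) (simp add: pos_le_divide_eq mult.commute)
    ultimately show ?thesis
      by simp
  qed
  have "\<forall>\<^sub>F n in sequentially. norm (A n ^ n - exp w)
      \<le> exp C * norm (real n *\<^sub>R (A n - 1) - real n *\<^sub>R (y n - 1))"
    using eventually_gt_at_top[of 0]
  proof eventually_elim
    case (elim n)
    have "y n ^ n = exp w"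
      using elim by (simp add: y_def flip: exp_scaleR_of_nat)
    then have "norm (A n ^ n - exp w) \<le> real n * (1 + C / real n) ^ n * norm (A n - y n)"
      using norm_power_diff_le[of "A n" "1 + C / real n" "y n" n] M[of n "A n"] M[of n "y n"]
        C1[of n] C2[of n] C0 elim by (simp add: C_def max.coboundedI1 max.coboundedI2)
    also have "\<dots> \<le> real n * exp (C / real n) ^ n * norm (A n - y n)"
      using C0 by (intro mult_right_mono mult_left_mono power_mono) auto
    also have "exp (C / real n) ^ n = exp C"
      using elim by (simp flip: exp_of_nat_mult)
    also have "real n * exp C * norm (A n - y n)
        = exp C * norm (real n *\<^sub>R (A n - 1) - real n *\<^sub>R (y n - 1))"
      by (simp flip: scaleR_diff_right)
    finally show ?case .
  qed
  moreover have "(\<lambda>n. exp C * norm (real n *\<^sub>R (A n - 1) - real n *\<^sub>R (y n - 1))) \<longlonglongrightarrow> 0"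
    using tendsto_mult[OF tendsto_const tendsto_norm[OF tendsto_diff[OF assms y]], of "exp C"] by simp
  ultimately show ?thesis
    by (subst Lim_null) (rule Lim_null_comparison)
qed

text \<open>To first order in \<open>1/n\<close> the product \<open>exp (u/n) exp (v/n)\<close> is \<open>1 + (u + v)/n\<close>,
  so Euler's limit applies.\<close>
lemma Lie_product_formula:
  fixes u v :: "nat \<Rightarrow> 'a::{real_normed_algebra_1,banach}"
  assumes u: "u \<longlonglongrightarrow> x" and v: "v \<longlonglongrightarrow> y"
  shows "(\<lambda>n. (exp ((1 / real n) *\<^sub>R u n) * exp ((1 / real n) *\<^sub>R v n)) ^ n) \<longlonglongrightarrow> exp (x + y)"
proof (rule power_tendsto_exp)
  let ?P = "\<lambda>n. exp ((1 / real n) *\<^sub>R u n)" and ?Q = "\<lambda>n. exp ((1 / real n) *\<^sub>R v n)"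
  have "(\<lambda>n. (1 / real n) *\<^sub>R v n) \<longlonglongrightarrow> 0"
    using tendsto_scaleR[OF lim_1_over_n v] by simp
  from tendsto_exp_Banach_algebra[OF this] have "?Q \<longlonglongrightarrow> 1"
    by simp
  from tendsto_add[OF tendsto_mult[OF scaled_exp_minus_one_tendsto[OF u] this]
      scaled_exp_minus_one_tendsto[OF v]]
  show "(\<lambda>n. real n *\<^sub>R (?P n * ?Q n - 1)) \<longlonglongrightarrow> x + y"
    by (simp add: algebra_simps)
qed

text \<open>Inversion is continuous: from \<open>b\<^sub>n - b = b\<^sub>n (a - a\<^sub>n) b\<close> the norms of the
  \<open>b\<^sub>n\<close> are eventually at most \<open>2 \<parallel>b\<parallel>\<close>, and then the same identity bounds the
  difference.\<close>
lemma tendsto_two_sided_inverse: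
  fixes A B :: "_ \<Rightarrow> 'a::real_normed_algebra_1"
  assumes lim: "(A \<longlongrightarrow> a) F" and inv: "\<And>n. B n * A n = 1" and "a * b = 1"
  shows "(B \<longlongrightarrow> b) F"
proof -
  have diff: "B n - b = B n * (a - A n) * b" for n
    using inv[of n] \<open>a * b = 1\<close> by (simp add: left_diff_distrib right_diff_distrib mult.assoc)
  have gap: "((\<lambda>n. norm (a - A n) * norm b) \<longlongrightarrow> 0) F"
    using tendsto_mult[OF tendsto_norm[OF tendsto_diff[OF tendsto_const[of a] lim]]
        tendsto_const[of "norm b"]] by simp
  then have half: "\<forall>\<^sub>F n in F. norm (a - A n) * norm b < 1 / 2"
    by (rule order_tendstoD) simp
  have "\<forall>\<^sub>F n in F. norm (B n - b) \<le> 2 * norm b * (norm (a - A n) * norm b)"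
    using half
  proof eventually_elim
    case (elim n)
    have le: "norm (B n - b) \<le> norm (B n) * (norm (a - A n) * norm b)"
      unfolding diff mult.assoc
      by (intro order_trans[OF norm_mult_ineq] mult_left_mono norm_mult_ineq norm_ge_zero)
    also have "\<dots> \<le> norm (B n) * (1 / 2)"
      using elim by (intro mult_left_mono) auto
    finally have "norm (B n) \<le> 2 * norm b"
      using norm_triangle_ineq[of b "B n - b"] by simp
    then show ?case
      by (intro order_trans[OF le] mult_right_mono mult_nonneg_nonneg norm_ge_zero)
  qed
  moreover have "((\<lambda>n. 2 * norm b * (norm (a - A n) * norm b)) \<longlongrightarrow> 0) F"
    using tendsto_mult[OF tendsto_const gap, of "2 * norm b"] by simp
  ultimately show ?thesis
    by (subst Lim_null) (rule Lim_null_comparison)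
qed

lemma exp_conjugate:
  fixes x g h :: "'a::{real_normed_algebra_1,banach}"
  assumes hg: "h * g = 1" and gh: "g * h = 1"
  shows "exp (g * x * h) = g * exp x * h"
proof -
  have power: "(g * x * h) ^ k = g * x ^ k * h" for k
  proof (induction k)
    case (Suc k)
    have "(g * x * h) ^ Suc k = g * x * h * (g * x ^ k * h)"
      by (simp only: power_Suc Suc)
    also have "\<dots> = g * x * (h * g) * x ^ k * h"
      by (simp only: mult.assoc)
    finally show ?case
      by (simp add: hg mult.assoc)
  qed (simp add: gh)
  have "(\<lambda>k. g * (x ^ k /\<^sub>R fact k) * h) sums (g * exp x * h)"
    by (intro sums_mult sums_mult2) (simp add: exp_def summable_exp_generic summable_sums)
  then show ?thesis
    by (simp add: exp_def power sums_iff)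
qed

section \<open>Square matrices as a Banach algebra\<close>

text \<open>Square matrices carry no algebra structure as elements of \<open>complex^'n^'n\<close>, where
  multiplication is componentwise. A copy of the
  type with matrix multiplication and the operator norm is a Banach algebra with unit, and makes the
  results on \<open>exp\<close> available for matrices.\<close>
typedef 'n operator_matrix = "UNIV :: (complex^'n^'n) set"
  morphisms matrix_of operator_of by simp

setup_lifting type_definition_operator_matrix

instantiation operator_matrix :: (finite) real_normed_algebra_1
begin

lift_definition zero_operator_matrix :: "'a operator_matrix" is 0 .
lift_definition one_operator_matrix :: "'a operator_matrix" is "mat 1" .
lift_definition plus_operator_matrix :: "'a operator_matrix \<Rightarrow> 'a operator_matrix \<Rightarrow> 'a operator_matrix"
  is "(+)" .
lift_definition minus_operator_matrix :: "'a operator_matrix \<Rightarrow> 'a operator_matrix \<Rightarrow> 'a operator_matrix"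
  is "(-)" .
lift_definition uminus_operator_matrix :: "'a operator_matrix \<Rightarrow> 'a operator_matrix"
  is "uminus" .
lift_definition times_operator_matrix :: "'a operator_matrix \<Rightarrow> 'a operator_matrix \<Rightarrow> 'a operator_matrix"
  is "(**)" .
lift_definition scaleR_operator_matrix :: "real \<Rightarrow> 'a operator_matrix \<Rightarrow> 'a operator_matrix"
  is "(*\<^sub>R)" .
lift_definition norm_operator_matrix :: "'a operator_matrix \<Rightarrow> real"
  is "\<lambda>A. onorm ((*v) A)" .

definition dist_operator_matrix :: "'a operator_matrix \<Rightarrow> 'a operator_matrix \<Rightarrow> real"
  where "dist_operator_matrix a b = norm (a - b)"

definition sgn_operator_matrix :: "'a operator_matrix \<Rightarrow> 'a operator_matrix"
  where "sgn_operator_matrix x = scaleR (inverse (norm x)) x"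

definition uniformity_operator_matrix :: "('a operator_matrix \<times> 'a operator_matrix) filter"
  where "uniformity_operator_matrix = (INF e\<in>{0 <..}. principal {(x, y). dist x y < e})"

definition open_operator_matrix :: "'a operator_matrix set \<Rightarrow> bool"
  where "open_operator_matrix S = (\<forall>x\<in>S. \<forall>\<^sub>F (x', y) in uniformity. x' = x \<longrightarrow> y \<in> S)"

instance
proof
  fix x y z :: "'a operator_matrix" and r s :: real
  show "x + y + z = x + (y + z)" by transfer (rule add.assoc)
  show "x + y = y + x" by transfer (rule add.commute)
  show "0 + x = x" by transfer simp
  show "- x + x = 0" by transfer simp
  show "x - y = x + - y" by transfer simp
  show "r *\<^sub>R (x + y) = r *\<^sub>R x + r *\<^sub>R y" by transfer (rule scaleR_add_right)
  show "(r + s) *\<^sub>R x = r *\<^sub>R x + s *\<^sub>R x" by transfer (rule scaleR_add_left)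
  show "r *\<^sub>R s *\<^sub>R x = (r * s) *\<^sub>R x" by transfer simp
  show "1 *\<^sub>R x = x" by transfer simp
  show "x * y * z = x * (y * z)" by transfer (simp add: matrix_mul_assoc)
  show "1 * x = x" by transfer simp
  show "x * 1 = x" by transfer simp
  show "(x + y) * z = x * z + y * z" by transfer (vector matrix_matrix_mult_def sum.distrib[symmetric] field_simps)
  show "x * (y + z) = x * y + x * z" by transfer (rule matrix_add_ldistrib)
  show "r *\<^sub>R x * y = r *\<^sub>R (x * y)" by transfer (rule scalar_matrix_assoc[symmetric])
  show "x * r *\<^sub>R y = r *\<^sub>R (x * y)" by transfer (simp only: matrix_scalar_ac scalar_matrix_assoc)
  show "(0 :: 'a operator_matrix) \<noteq> 1"
    by transfer (simp add: vec_eq_iff mat_def)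
  show "dist x y = norm (x - y)" by (rule dist_operator_matrix_def)
  show "sgn x = scaleR (inverse (norm x)) x" by (rule sgn_operator_matrix_def)
  show "(uniformity :: ('a operator_matrix \<times> 'a operator_matrix) filter)
      = (INF e\<in>{0 <..}. principal {(x, y). dist x y < e})"
    by (rule uniformity_operator_matrix_def)
  show "open S = (\<forall>x\<in>S. \<forall>\<^sub>F (x', y) in uniformity. x' = x \<longrightarrow> y \<in> S)"
    for S :: "'a operator_matrix set"
    by (rule open_operator_matrix_def)
  show "norm x = 0 \<longleftrightarrow> x = 0"
    by transfer (simp add: onorm_eq_0 matrix_eq)
  have "(*v) (A + B) = (\<lambda>v. A *v v + B *v v)" for A B :: "complex^'a^'a"
    by (simp add: fun_eq_iff matrix_vector_mult_add_rdistrib)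
  then show "norm (x + y) \<le> norm x + norm y"
    by transfer (simp add: onorm_triangle)
  have "(*v) (r *\<^sub>R A) = (\<lambda>v. r *\<^sub>R (A *v v))" for r and A :: "complex^'a^'a"
    by (simp add: fun_eq_iff matrix_vector_mult_def vec_eq_iff scaleR_sum_right)
  then show "norm (r *\<^sub>R x) = \<bar>r\<bar> * norm x"
    by transfer (simp add: onorm_scaleR)
  show "norm (x * y) \<le> norm x * norm y"
  proof transfer
    fix x y :: "complex^'a^'a"
    have "(*v) (x ** y) = (*v) x \<circ> (*v) y"
      by (simp add: fun_eq_iff matrix_vector_mul_assoc)
    then show "onorm ((*v) (x ** y)) \<le> onorm ((*v) x) * onorm ((*v) y)"
      by (simp add: onorm_compose)
  qed
  have "(*v) (mat 1) = (\<lambda>v :: complex^'a. v)"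
    by (simp add: fun_eq_iff)
  then show "norm (1 :: 'a operator_matrix) = 1"
    by transfer (simp add: onorm_id)
qed

end

lemma matrix_of_operator_of [simp]: "matrix_of (operator_of A) = A"
  by (simp add: operator_of_inverse)

lemma operator_of_simps:
  fixes A B :: "complex^'n^'n"
  shows "operator_of (mat 1) = (1 :: 'n operator_matrix)"
    and "operator_of 0 = (0 :: 'n operator_matrix)"
    and "operator_of (A + B) = operator_of A + operator_of B"
    and "operator_of (A - B) = operator_of A - operator_of B"
    and "operator_of (A ** B) = operator_of A * operator_of B"
    and "operator_of (r *\<^sub>R A) = r *\<^sub>R operator_of A"
  by (simp_all add: one_operator_matrix.abs_eq zero_operator_matrix.abs_eq
      plus_operator_matrix.abs_eq minus_operator_matrix.abs_eq times_operator_matrix.abs_eq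
      scaleR_operator_matrix.abs_eq eq_onp_def)

text \<open>On the finite-dimensional space of matrices the operator norm and the Euclidean norm are
  equivalent; the next two lemmas are the two inequalities.\<close>

lemma bounded_linear_operator_of: "bounded_linear (operator_of :: complex^'n^'n \<Rightarrow> _)"
proof (rule bounded_linear_intro)
  fix A :: "complex^'n^'n"
  have "norm (A *v x) \<le> norm A * norm x" for x
  proof -
    have row: "norm ((A *v x) $ i) \<le> norm (A $ i) * norm x" for i
    proof -
      have "norm ((A *v x) $ i) \<le> (\<Sum>j\<in>UNIV. norm (A $ i $ j) * norm (x $ j))"
        unfolding matrix_vector_mult_def by (simp add: sum_norm_le norm_mult)
      also have "\<dots> \<le> norm (A $ i) * norm x"
        unfolding norm_vec_def using L2_set_mult_ineq[of "\<lambda>j. norm (A $ i $ j)" "\<lambda>j. norm (x $ j)" UNIV]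
        by simp
      finally show ?thesis .
    qed
    have "norm (A *v x) \<le> L2_set (\<lambda>i. norm (A $ i) * norm x) UNIV"
      unfolding norm_vec_def[of "A *v x"] by (rule L2_set_mono) (simp_all add: row)
    also have "\<dots> = norm A * norm x"
      by (simp add: norm_vec_def[of A] L2_set_left_distrib)
    finally show ?thesis .
  qed
  then have "onorm ((*v) A) \<le> norm A"
    by (rule onorm_le)
  then show "norm (operator_of A) \<le> norm A * 1"
    by (simp add: norm_operator_matrix.rep_eq)
qed (simp_all add: operator_of_simps)

lemma bounded_linear_matrix_of: "bounded_linear (matrix_of :: 'n::finite operator_matrix \<Rightarrow> _)"
proof (rule bounded_linear_intro)
  fix a :: "'n operator_matrix"
  let ?A = "matrix_of a"
  have entry: "norm (?A $ i $ j) \<le> norm a" for i j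
  proof -
    have "?A $ i $ j = (?A *v axis j 1) $ i"
      by (simp add: matrix_vector_mult_def axis_def if_distrib cong: if_cong)
    also have "norm \<dots> \<le> norm (?A *v axis j 1)"
      by (rule Finite_Cartesian_Product.norm_nth_le)
    also have "\<dots> \<le> onorm ((*v) ?A) * norm (axis j 1 :: complex^'n)"
      by (rule onorm) simp
    finally show ?thesis
      by (simp add: norm_operator_matrix.rep_eq)
  qed
  have "norm ?A \<le> (\<Sum>i\<in>UNIV. norm (?A $ i))"
    unfolding norm_vec_def[of ?A] by (rule L2_set_le_sum) simp
  also have "\<dots> \<le> (\<Sum>i\<in>UNIV. \<Sum>j\<in>UNIV. norm (?A $ i $ j))"
    unfolding norm_vec_def by (intro sum_mono L2_set_le_sum) simp
  also have "\<dots> \<le> (\<Sum>i\<in>(UNIV::'n set). \<Sum>j\<in>(UNIV::'n set). norm a)"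
    by (intro sum_mono entry)
  finally show "norm ?A \<le> norm a * (real CARD('n) * real CARD('n))"
    by (simp add: algebra_simps)
qed (simp_all add: plus_operator_matrix.rep_eq scaleR_operator_matrix.rep_eq)

instance operator_matrix :: (finite) banach
proof
  fix X :: "nat \<Rightarrow> 'a operator_matrix"
  assume "Cauchy X"
  then have "Cauchy (\<lambda>n. matrix_of (X n))"
    by (rule bounded_linear.Cauchy[OF bounded_linear_matrix_of])
  then obtain L where "(\<lambda>n. matrix_of (X n)) \<longlonglongrightarrow> L"
    using Cauchy_convergent_iff convergent_def by blast
  from bounded_linear.tendsto[OF bounded_linear_operator_of this]
  show "convergent X"
    by (simp add: matrix_of_inverse convergent_def) blast
qed

lemma tendsto_operator_of_iff:
  fixes f :: "_ \<Rightarrow> complex^'n^'n"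
  shows "((\<lambda>x. operator_of (f x)) \<longlongrightarrow> operator_of A) F \<longleftrightarrow> (f \<longlongrightarrow> A) F"
  using bounded_linear.tendsto[OF bounded_linear_matrix_of, of "\<lambda>x. operator_of (f x)" "operator_of A" F]
    bounded_linear.tendsto[OF bounded_linear_operator_of, of f A F] by auto

section \<open>The matrix exponential\<close>

lemma operator_of_matrix_power: "operator_of (matrix_power A k) = operator_of A ^ k"
  by (induction k) (simp_all add: operator_of_simps)

text \<open>Facts about \<open>matrix_exp\<close> are obtained by transporting them along \<open>operator_of\<close>,
  a linear homeomorphism that turns it into the exponential of a Banach algebra.\<close>
lemma operator_of_matrix_exp:
  fixes A :: "complex^'n^'n"
  shows "operator_of (matrix_exp A) = exp (operator_of A)"
proof -
  have "(\<lambda>k. operator_of A ^ k /\<^sub>R fact k) sums exp (operator_of A)"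
    by (simp add: exp_def summable_exp_generic summable_sums)
  from bounded_linear.sums[OF bounded_linear_matrix_of this]
  have "(\<lambda>k. (1 / fact k) *\<^sub>R matrix_power A k) sums matrix_of (exp (operator_of A))"
    by (simp add: scaleR_operator_matrix.rep_eq inverse_eq_divide flip: operator_of_matrix_power)
  then show ?thesis
    by (simp add: matrix_exp_def sums_iff matrix_of_inverse)
qed

lemma matrix_eq_via_operator: "A = B \<longleftrightarrow> operator_of A = operator_of B"
  by (metis matrix_of_operator_of)

lemma matrix_exp_zero [simp]: "matrix_exp 0 = mat 1"
  by (simp add: matrix_eq_via_operator operator_of_matrix_exp operator_of_simps)

lemma matrix_exp_add_multiples:
  "matrix_exp (s *\<^sub>R A) ** matrix_exp (t *\<^sub>R A) = matrix_exp ((s + t) *\<^sub>R A)"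
  by (simp add: matrix_eq_via_operator operator_of_matrix_exp operator_of_simps scaleR_add_left
      exp_add_commuting)

lemma matrix_exp_minus:
  "matrix_exp A ** matrix_exp (- A) = mat 1" "matrix_exp (- A) ** matrix_exp A = mat 1"
  using matrix_exp_add_multiples[of 1 A "-1"] matrix_exp_add_multiples[of "-1" A 1] by simp_all

lemma invertible_matrix_exp: "invertible (matrix_exp A)"
  using matrix_exp_minus invertible_def by blast

lemma matrix_inv_mult:
  assumes "invertible A"
  shows "A ** matrix_inv A = mat 1" "matrix_inv A ** A = mat 1"
  using assms someI_ex[of "\<lambda>B. A ** B = mat 1 \<and> B ** A = mat 1"]
  unfolding invertible_def matrix_inv_def by auto

lemma matrix_exp_conjugate:
  fixes A X :: "complex^'n^'n"
  assumes "invertible A"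
  shows "matrix_exp (A ** X ** matrix_inv A) = A ** matrix_exp X ** matrix_inv A"
  using exp_conjugate[of "operator_of (matrix_inv A)" "operator_of A" "operator_of X"]
    matrix_inv_mult[OF assms, THEN arg_cong[of _ _ operator_of]]
  by (simp add: operator_of_simps matrix_eq_via_operator operator_of_matrix_exp)

lemma tendsto_matrix_exp:
  fixes f :: "_ \<Rightarrow> complex^'n^'n"
  assumes "(f \<longlongrightarrow> A) F"
  shows "((\<lambda>x. matrix_exp (f x)) \<longlongrightarrow> matrix_exp A) F"
  using assms tendsto_exp_Banach_algebra
  by (simp add: operator_of_matrix_exp flip: tendsto_operator_of_iff)

lemma bounded_bilinear_matrix_mult:
  "bounded_bilinear ((**) :: complex^'n^'n \<Rightarrow> complex^'n^'n \<Rightarrow> complex^'n^'n)"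
proof -
  have eq: "A ** B = matrix_of (operator_of A * operator_of B)" for A B :: "complex^'n^'n"
    by (simp flip: operator_of_simps)
  have "bilinear ((**) :: complex^'n^'n \<Rightarrow> complex^'n^'n \<Rightarrow> complex^'n^'n)"
    unfolding bilinear_def linear_iff
    by (auto simp: eq operator_of_simps algebra_simps plus_operator_matrix.rep_eq scaleR_operator_matrix.rep_eq)
  then show ?thesis
    by (simp add: bilinear_conv_bounded_bilinear)
qed

lemmas tendsto_matrix_mult = bounded_bilinear.tendsto[OF bounded_bilinear_matrix_mult]

lemmas continuous_on_matrix_mult = bounded_bilinear.continuous_on[OF bounded_bilinear_matrix_mult]

lemma matrix_inv_unique:
  assumes "A ** B = mat 1" "B ** A = mat 1"
  shows "matrix_inv A = B"
  using assms matrix_inv_mult[of A] by (metis invertible_def matrix_mul_assoc matrix_mul_lid matrix_mul_rid)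

lemma matrix_exp_Lie_product_formula:
  fixes u v :: "nat \<Rightarrow> complex^'n^'n"
  assumes "u \<longlonglongrightarrow> A" "v \<longlonglongrightarrow> B"
  shows "(\<lambda>n. matrix_power (matrix_exp ((1 / real n) *\<^sub>R u n) ** matrix_exp ((1 / real n) *\<^sub>R v n)) n)
    \<longlonglongrightarrow> matrix_exp (A + B)"
  using assms Lie_product_formula[of "\<lambda>n. operator_of (u n)" "operator_of A"
      "\<lambda>n. operator_of (v n)" "operator_of B"]
  by (simp add: operator_of_matrix_exp operator_of_matrix_power operator_of_simps
      flip: tendsto_operator_of_iff)

lemma continuous_on_matrix_inv:
  "continuous_on {A :: complex^'n^'n. invertible A} matrix_inv"
  unfolding continuous_on_sequentially
proof (intro allI ballI impI, elim conjE)
  fix X :: "nat \<Rightarrow> complex^'n^'n" and A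
  assume A: "A \<in> {A. invertible A}" and X: "\<forall>n. X n \<in> {A. invertible A}" "X \<longlonglongrightarrow> A"
  have "(\<lambda>n. operator_of (matrix_inv (X n))) \<longlonglongrightarrow> operator_of (matrix_inv A)"
  proof (rule tendsto_two_sided_inverse)
    show "(\<lambda>n. operator_of (X n)) \<longlonglongrightarrow> operator_of A"
      using X by (simp add: tendsto_operator_of_iff)
    show "operator_of (matrix_inv (X n)) * operator_of (X n) = 1" for n
      using X matrix_inv_mult(2)[of "X n"] by (simp flip: operator_of_simps)
    show "operator_of A * operator_of (matrix_inv A) = 1"
      using A matrix_inv_mult(1)[of A] by (simp flip: operator_of_simps)
  qed
  then show "(matrix_inv \<circ> X) \<longlonglongrightarrow> matrix_inv A"
    by (simp add: tendsto_operator_of_iff o_def)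
qed

lemma open_invertible: "open {A :: complex^'n^'n. invertible A}"
proof -
  have "{A :: complex^'n^'n. invertible A} = {A. det A \<noteq> 0}"
    by (simp add: invertible_det_nz)
  moreover have "open {A :: complex^'n^'n. det A \<noteq> 0}"
    unfolding det_def by (intro open_Collect_neq continuous_intros)
  ultimately show ?thesis by simp
qed

section \<open>Bijective parametrizations of homogeneous spaces\<close>

text \<open>A continuous bijection \<open>E\<close> from a finite-dimensional space \<open>V\<close> onto a completely
  metrizable homogeneous space \<open>S\<close> has a continuous inverse \<open>L\<close>. The set \<open>S\<close> is the
  union of the compact images of the balls of \<open>V\<close>, so one of these images contains an open
  set \<open>W\<close>, by Baire; on this image \<open>L\<close> is continuous by compactness. Near an arbitrary
  point \<open>u0\<close> of \<open>V\<close>, move \<open>E u0\<close> into \<open>W\<close> by a continuous injective map \<open>\<phi>\<close>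
  and go back to \<open>V\<close> by \<open>L\<close>: the resulting map \<open>\<psi>\<close> is a continuous injection of
  an open piece of \<open>V\<close> into \<open>V\<close>, hence open by invariance of domain. Therefore \<open>E\<close> is open at \<open>u0\<close>.\<close>
lemma homogeneous_image_homeomorphism:
  fixes E :: "'a::euclidean_space \<Rightarrow> 'b::t2_space"
  assumes V: "subspace V" and cont: "continuous_on V E" and inj: "inj_on E V"
    and S: "E ` V = S" and complete: "completely_metrizable_space (top_of_set S)"
    and homogeneous: "\<And>x y. x \<in> S \<Longrightarrow> y \<in> S \<Longrightarrow>
      \<exists>\<phi>. continuous_on S \<phi> \<and> \<phi> \<in> S \<rightarrow> S \<and> inj_on \<phi> S \<and> \<phi> x = y"
  shows "continuous_on S (inv_into V E)"
proof -
  let ?L = "inv_into V E"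
  have L: "?L y \<in> V" "E (?L y) = y" if "y \<in> S" for y
    using that S by (auto intro: inv_into_into f_inv_into_f)
  define K where "K m = V \<inter> cball 0 (real m)" for m :: nat
  have compact_K: "compact (K m)" for m
    unfolding K_def using V by (simp add: closed_subspace closed_Int_compact)
  have K_V: "K m \<subseteq> V" for m
    by (auto simp: K_def)
  have cover: "S = (\<Union>m. E ` K m)"
  proof -
    have "x \<in> (\<Union>m. K m)" if "x \<in> V" for x
      using that real_arch_simple[of "norm x"] by (auto simp: K_def)
    then have "V = (\<Union>m. K m)"
      using K_V by blast
    then show ?thesis
      using S by blast
  qed
  have closed_K: "closedin (top_of_set S) (E ` K m)" for m
    using compact_continuous_image[OF continuous_on_subset[OF cont K_V] compact_K]
    by (intro closed_subset compact_imp_closed) (use S K_V in blast)+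
  have "\<exists>m. top_of_set S interior_of (E ` K m) \<noteq> {}"
  proof (rule ccontr)
    assume "\<not> ?thesis"
    then have "top_of_set S interior_of (\<Union>m. E ` K m) = {}"
      using closed_K complete by (intro Baire_category_alt) auto
    moreover have "top_of_set S interior_of S = S"
      using interior_of_topspace[of "top_of_set S"] by simp
    moreover have "S \<noteq> {}"
      using S V subspace_0 by blast
    ultimately show False
      using cover by simp
  qed
  then obtain m y W where W: "openin (top_of_set S) W" "W \<subseteq> E ` K m" "y \<in> W"
    by (metis all_not_in_conv interior_of_subset openin_interior_of)
  have W_S: "W \<subseteq> S" and "y \<in> S"
    using W openin_imp_subset by blast+
  have cont_L_W: "continuous_on W ?L"
  proof -
    have "continuous_on (E ` K m) (inv_into V E)"
    proof (rule continuous_on_inv[OF continuous_on_subset[OF cont K_V] compact_K])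
      show "\<forall>x\<in>K m. inv_into V E (E x) = x"
        using inj K_V by (auto intro: inv_into_f_f)
    qed
    then show ?thesis
      using W continuous_on_subset by blast
  qed
  have nbhd: "\<exists>N. openin (top_of_set S) N \<and> E u0 \<in> N \<and> N \<subseteq> E ` U"
    if U: "openin (top_of_set V) U" and u0: "u0 \<in> U" for U u0
  proof -
    have U_V: "U \<subseteq> V"
      using U openin_imp_subset by blast
    then have "E u0 \<in> S"
      using u0 S by blast
    then obtain \<phi> where \<phi>: "continuous_on S \<phi>" "\<phi> \<in> S \<rightarrow> S" "inj_on \<phi> S" "\<phi> (E u0) = y"
      using homogeneous \<open>y \<in> S\<close> by blast
    define U' where "U' = U \<inter> (V \<inter> (\<lambda>u. \<phi> (E u)) -` W)"
    have cont_\<phi>E: "continuous_on V (\<lambda>u. \<phi> (E u))"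
      using continuous_on_compose2[OF \<phi>(1) cont] S by blast
    have "openin (top_of_set V) (V \<inter> (\<lambda>u. \<phi> (E u)) -` W)"
      using continuous_openin_preimage[OF cont_\<phi>E _ W(1)] \<phi>(2) S by blast
    then have open_U': "openin (top_of_set V) U'"
      using openin_Int[OF U] by (simp add: U'_def)
    have U'_V: "U' \<subseteq> V" and u0': "u0 \<in> U'"
      using u0 U_V \<phi>(4) W(3) by (auto simp: U'_def)
    define \<psi> where "\<psi> u = ?L (\<phi> (E u))" for u
    have \<phi>E: "\<phi> (E u) \<in> W" "\<phi> (E u) \<in> S" "E u \<in> S" if "u \<in> U'" for u
      using that W_S U'_V S by (auto simp: U'_def)
    have "openin (top_of_set V) (\<psi> ` U')"
    proof (rule invariance_of_domain_subspaces[OF open_U' V V order_refl])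
      show "continuous_on U' \<psi>"
        unfolding \<psi>_def
        by (rule continuous_on_compose2[OF cont_L_W continuous_on_subset[OF cont_\<phi>E U'_V]])
          (use \<phi>E in auto)
      show "\<psi> \<in> U' \<rightarrow> V"
        using L \<phi>E by (auto simp: \<psi>_def)
      show "inj_on \<psi> U'"
        unfolding \<psi>_def
        by (intro inj_onI) (metis L(2) \<phi>E(2,3) \<phi>(3) inj inj_onD U'_V subsetD)
    qed
    then have "openin (top_of_set W) (W \<inter> ?L -` (\<psi> ` U'))"
      by (intro continuous_openin_preimage[OF cont_L_W]) (use L W_S in auto)
    then have O: "openin (top_of_set S) (W \<inter> ?L -` (\<psi> ` U'))"
      using W(1) openin_trans by blast
    \<comment> \<open>\<open>N\<close> is the pullback of an open set along \<open>\<phi>\<close>, and injectivity of \<open>\<phi>\<close> and \<open>L\<close>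
      identifies it with \<open>E ` U'\<close>.\<close>
    define N where "N = S \<inter> \<phi> -` (W \<inter> ?L -` (\<psi> ` U'))"
    have "openin (top_of_set S) N"
      unfolding N_def by (rule continuous_openin_preimage[OF \<phi>(1,2) O])
    moreover have "E u0 \<in> N"
      using u0' \<phi>E by (auto simp: N_def \<psi>_def)
    moreover have "N \<subseteq> E ` U"
    proof
      fix g
      assume g: "g \<in> N"
      then obtain u where u: "u \<in> U'" "?L (\<phi> g) = ?L (\<phi> (E u))"
        by (auto simp: N_def \<psi>_def)
      then have "\<phi> g = \<phi> (E u)"
        using g \<phi>E L(2) \<phi>(2) by (metis IntD1 N_def Pi_mem)
      then have "g = E u"
        using g u \<phi>(3) \<phi>E(3) by (auto simp: N_def dest: inj_onD)
      then show "g \<in> E ` U"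
        using u by (auto simp: U'_def)
    qed
    ultimately show ?thesis
      by blast
  qed
  have "openin (top_of_set S) (E ` U)" if "openin (top_of_set V) U" for U
    by (subst openin_subopen) (use nbhd[OF that] in blast)
  then show ?thesis
    by (intro continuous_on_inverse_open_map[OF cont S]) (use inj in auto)
qed

section \<open>Groups parametrized by an exponential map\<close>

text \<open>The Lie product axiom speaks of moving elements \<open>us n\<close>, \<open>vs n\<close> whose
  \<^emph>\<open>exponentials\<close> converge. It thus combines the product formula with continuity of the
  logarithm, and lets \<open>V\<close> do without a topology of its own. Scaling and addition are
  parameters, because \<open>V\<close> is a set of functions in one of the two instances.\<close>
locale exponential_group = topological_group G T
  for G (structure) and T +
  fixes E :: "'v \<Rightarrow> 'a" and V :: "'v set"
    and scale :: "real \<Rightarrow> 'v \<Rightarrow> 'v" and add :: "'v \<Rightarrow> 'v \<Rightarrow> 'v"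
  assumes Hausdorff: "Hausdorff_space T"
    and bij: "bij_betw E V (carrier G)"
    and scale_closed: "u \<in> V \<Longrightarrow> scale t u \<in> V"
    and add_closed: "u \<in> V \<Longrightarrow> v \<in> V \<Longrightarrow> add u v \<in> V"
    and scale_one: "scale 1 u = u"
    and scale_scale: "scale s (scale t u) = scale (s * t) u"
    and one_parameter: "u \<in> V \<Longrightarrow> E (scale s u) \<otimes> E (scale t u) = E (scale (s + t) u)"
    and small_tendsto_one: "u \<in> V \<Longrightarrow> limitin T (\<lambda>n. E (scale (1 / real n) u)) \<one> sequentially"
    and Lie_product:
    "\<lbrakk>u \<in> V; v \<in> V; \<And>n. us n \<in> V; \<And>n. vs n \<in> V;
      limitin T (\<lambda>n. E (us n)) (E u) sequentially; limitin T (\<lambda>n. E (vs n)) (E v) sequentially\<rbrakk>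
     \<Longrightarrow> limitin T (\<lambda>n. (E (scale (1 / real n) (us n)) \<otimes> E (scale (1 / real n) (vs n))) [^] n)
           (E (add u v)) sequentially"
begin

lemma unique_limit_iff: "unique_limit T X l \<longleftrightarrow> limitin T X l sequentially"
  using limitin_Hausdorff_unique[OF _ _ trivial_limit_sequentially Hausdorff]
  unfolding unique_limit_def by blast

lemma E_closed: "u \<in> V \<Longrightarrow> E u \<in> carrier G"
  using bij bij_betwE by blast

lemma E_cases:
  assumes "a \<in> carrier G"
  obtains u where "u \<in> V" "a = E u"
  using assms bij unfolding bij_betw_def by blast

lemma E_zero: "u \<in> V \<Longrightarrow> E (scale 0 u) = \<one>"
  using one_parameter[of u 0 0] E_closed[OF scale_closed[of u 0]] r_cancel_one by auto

lemma E_inverse: "u \<in> V \<Longrightarrow> inv (E (scale t u)) = E (scale (- t) u)"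
  using one_parameter[of u "- t" t] E_zero E_closed scale_closed
  by (intro inv_equality) auto

lemma E_nat_power: "u \<in> V \<Longrightarrow> E (scale t u) [^] n = E (scale (real n * t) u)"
proof (induction n)
  case (Suc n)
  then show ?case
    using one_parameter[of u "real n * t" t] by (simp add: algebra_simps)
qed (simp add: E_zero)

lemma E_int_power: "u \<in> V \<Longrightarrow> E (scale t u) [^] (k :: int) = E (scale (of_int k * t) u)"
proof (cases "k < 0")
  case True
  then obtain n where "k = - int n"
    by (metis neg_int_cases)
  then show "E (scale t u) [^] k = E (scale (of_int k * t) u)" if "u \<in> V"
    using that by (simp add: int_pow_neg int_pow_int E_nat_power E_inverse E_closed scale_closed)
next
  case False
  then obtain n where "k = int n"
    using nonneg_int_cases by (metis not_less)
  then show "E (scale t u) [^] k = E (scale (of_int k * t) u)" if "u \<in> V"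
    using that by (simp add: int_pow_int E_nat_power)
qed

lemma bij_betw_E_power:
  assumes "k \<noteq> 0"
  shows "bij_betw (\<lambda>x. x [^] (k :: int)) (carrier G) (carrier G)"
proof (rule bij_betw_byWitness[where f' = "\<lambda>a. E (scale (1 / of_int k) (inv_into V E a))"])
  have inv_E: "inv_into V E (E u) = u" if "u \<in> V" for u
    using bij_betw_inv_into_left[OF bij that] .
  have power: "E u [^] k = E (scale (of_int k) u)" if "u \<in> V" for u
    using E_int_power[OF that, of 1] by (simp add: scale_one)
  show "\<forall>a\<in>carrier G. E (scale (1 / of_int k) (inv_into V E (a [^] k))) = a"
    using assms by (auto elim!: E_cases simp: power inv_E scale_closed scale_scale scale_one)
  show "\<forall>a\<in>carrier G. E (scale (1 / of_int k) (inv_into V E a)) [^] k = a"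
    using assms by (auto elim!: E_cases simp: E_int_power inv_E scale_one)
  show "(\<lambda>x. x [^] k) ` carrier G \<subseteq> carrier G"
    by auto
  show "(\<lambda>a. E (scale (1 / of_int k) (inv_into V E a))) ` carrier G \<subseteq> carrier G"
    by (auto elim!: E_cases simp: inv_E E_closed scale_closed)
qed

lemma group_root_E:
  assumes "k \<noteq> 0" "u \<in> V"
  shows "group_root G k (E u) = E (scale (1 / of_int k) u)"
  unfolding group_root_def
proof (rule inv_into_f_eq)
  show "inj_on (\<lambda>x. x [^] k) (carrier G)"
    using bij_betw_E_power[OF assms(1)] bij_betw_def by blast
  show "E (scale (1 / of_int k) u) [^] k = E u"
    using assms by (simp add: E_int_power scale_one)
qed (simp add: assms E_closed scale_closed)

lemma group_root_tendsto_one: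
  assumes "a \<in> carrier G"
  shows "limitin T (\<lambda>n. group_root G (int n) a) \<one> sequentially"
  using assms
proof (rule E_cases)
  fix u
  assume u: "u \<in> V" "a = E u"
  have "\<forall>\<^sub>F n in sequentially. E (scale (1 / real n) u) = group_root G (int n) a"
    using eventually_gt_at_top[of 0] by eventually_elim (simp add: u group_root_E)
  then show ?thesis
    by (rule limitin_transform_eventually) (rule small_tendsto_one[OF u(1)])
qed

lemma root_product_limit:
  assumes u: "u \<in> V" "\<And>n. us n \<in> V" "limitin T (\<lambda>n. E (us n)) (E u) sequentially"
    and v: "v \<in> V" "\<And>n. vs n \<in> V" "limitin T (\<lambda>n. E (vs n)) (E v) sequentially"
  shows "limitin T (\<lambda>n. (group_root G (int n) (E (us n)) \<otimes> group_root G (int n) (E (vs n))) [^] n)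
    (E (add u v)) sequentially"
proof (rule limitin_transform_eventually)
  show "limitin T (\<lambda>n. (E (scale (1 / real n) (us n)) \<otimes> E (scale (1 / real n) (vs n))) [^] n)
    (E (add u v)) sequentially"
    by (intro Lie_product u v)
  show "\<forall>\<^sub>F n in sequentially.
      (E (scale (1 / real n) (us n)) \<otimes> E (scale (1 / real n) (vs n))) [^] n
      = (group_root G (int n) (E (us n)) \<otimes> group_root G (int n) (E (vs n))) [^] n"
    using eventually_gt_at_top[of 0] by eventually_elim (simp add: u v group_root_E)
qed

sublocale lim_Q_group G T
proof
  show "bij_betw (\<lambda>x. x [^] n) (carrier G) (carrier G)" if "n \<noteq> 0" for n :: int
    by (rule bij_betw_E_power[OF that])
  show "unique_limit T (\<lambda>n. group_root G (int n) a) \<one>" if "a \<in> carrier G" for a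
    using group_root_tendsto_one[OF that] by (simp add: unique_limit_iff)
  show "\<exists>l. unique_limit T (\<lambda>n. (group_root G (int n) a \<otimes> group_root G (int n) b) [^] n) l \<and>
      (\<forall>a' b'. (\<forall>n. a' n \<in> carrier G) \<and> (\<forall>n. b' n \<in> carrier G) \<and>
           limitin T a' a sequentially \<and> limitin T b' b sequentially \<longrightarrow>
         unique_limit T (\<lambda>n. (group_root G (int n) (a' n) \<otimes> group_root G (int n) (b' n)) [^] n) l)"
    if a: "a \<in> carrier G" and b: "b \<in> carrier G" for a b
  proof -
    let ?L = "inv_into V E"
    have L: "?L x \<in> V" "E (?L x) = x" if "x \<in> carrier G" for x
      using that bij by (auto simp: bij_betw_def inv_into_into f_inv_into_f)
    have lim: "limitin T (\<lambda>n. (group_root G (int n) (a' n) \<otimes> group_root G (int n) (b' n)) [^] n)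
        (E (add (?L a) (?L b))) sequentially"
      if "\<And>n. a' n \<in> carrier G" "\<And>n. b' n \<in> carrier G"
        "limitin T a' a sequentially" "limitin T b' b sequentially" for a' b'
      using root_product_limit[of "?L a" "\<lambda>n. ?L (a' n)" "?L b" "\<lambda>n. ?L (b' n)"] that a b
      by (simp add: L)
    have const: "limitin T (\<lambda>n. x) x sequentially" if "x \<in> carrier G" for x
      using that by (simp add: limitin_const_iff topspace_eq)
    show ?thesis
      using lim lim[of "\<lambda>n. a" "\<lambda>n. b"] a b const unfolding unique_limit_iff by blast
  qed
qed

lemma conjugated_root_product_limit:
  assumes u: "u \<in> V" and v: "v \<in> V" and w: "w \<in> V" and g: "g \<in> carrier G"
    and conj: "\<And>t. E (scale t w) = g \<otimes> E (scale t v) \<otimes> inv g"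
  shows "limitin T (\<lambda>n. (group_root G (int n) (E u) \<otimes> g \<otimes> group_root G (int n) (E v) \<otimes> inv g) [^] n)
    (E (add u w)) sequentially"
proof (rule limitin_transform_eventually)
  have const: "limitin T (\<lambda>n. x) x sequentially" if "x \<in> carrier G" for x
    using that by (simp add: limitin_const_iff topspace_eq)
  show "limitin T (\<lambda>n. (E (scale (1 / real n) u) \<otimes> E (scale (1 / real n) w)) [^] n)
    (E (add u w)) sequentially"
    using u w by (intro Lie_product const E_closed)
  show "\<forall>\<^sub>F n in sequentially. (E (scale (1 / real n) u) \<otimes> E (scale (1 / real n) w)) [^] n
      = (group_root G (int n) (E u) \<otimes> g \<otimes> group_root G (int n) (E v) \<otimes> inv g) [^] n"
    using eventually_gt_at_top[of 0]
    by eventually_elim (simp add: u v g group_root_E conj E_closed scale_closed m_assoc)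
qed

text \<open>The limit in the Rota-Baxter identity always exists and equals
  \<open>E (u + Ad (B (E u)) v)\<close>; uniqueness of limits identifies it with the limit in the
  definition.\<close>
theorem limit_weight_zero_Rota_Baxter_iff:
  assumes B: "B \<in> carrier G \<rightarrow> carrier G"
    and Ad_closed: "\<And>g v. g \<in> carrier G \<Longrightarrow> v \<in> V \<Longrightarrow> Ad g v \<in> V"
    and Ad: "\<And>g v t. g \<in> carrier G \<Longrightarrow> v \<in> V \<Longrightarrow> E (scale t (Ad g v)) = g \<otimes> E (scale t v) \<otimes> inv g"
  shows "limit_weight_zero_Rota_Baxter G T B \<longleftrightarrow>
    (\<forall>u\<in>V. \<forall>v\<in>V. B (E u) \<otimes> B (E v) = B (E (add u (Ad (B (E u)) v))))"
    (is "?RB \<longleftrightarrow> ?formula")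
proof -
  let ?X = "\<lambda>a b n. (group_root G (int n) a \<otimes> B a \<otimes> group_root G (int n) b \<otimes> inv (B a)) [^] n"
  have lim: "unique_limit T (?X (E u) (E v)) (E (add u (Ad (B (E u)) v)))"
    if "u \<in> V" "v \<in> V" for u v
    using that B conjugated_root_product_limit[of u v "Ad (B (E u)) v" "B (E u)"] E_closed[of u]
    by (auto simp: unique_limit_iff Ad_closed Ad)
  show ?thesis
  proof
    assume ?RB
    then interpret limit_weight_zero_Rota_Baxter G T B .
    show ?formula
    proof (intro ballI)
      fix u v
      assume uv: "u \<in> V" "v \<in> V"
      then obtain l where l: "unique_limit T (?X (E u) (E v)) l" "B (E u) \<otimes> B (E v) = B l"
        using Rota_Baxter[of "E u" "E v"] E_closed by blast
      have "l = E (add u (Ad (B (E u)) v))"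
        using lim[OF uv] l(1) unfolding unique_limit_def by blast
      with l(2) show "B (E u) \<otimes> B (E v) = B (E (add u (Ad (B (E u)) v)))"
        by simp
    qed
  next
    assume formula: ?formula
    show ?RB
    proof
      show "B \<in> carrier G \<rightarrow> carrier G"
        by (rule B)
      show "\<exists>l. unique_limit T (?X a b) l \<and> B a \<otimes> B b = B l"
        if ab: "a \<in> carrier G" "b \<in> carrier G" for a b
      proof -
        obtain u v where uv: "u \<in> V" "a = E u" "v \<in> V" "b = E v"
          using ab by (meson E_cases)
        then show ?thesis
          using lim formula by blast
      qed
    qed
  qed
qed

end

section \<open>Matrix Lie groups with bijective exponential map\<close>

lemma group_GL: "group (GL :: (complex^'n^'n) monoid)"
proof (rule groupI)
  fix x y z :: "complex^'n^'n"
  assume "x \<in> carrier GL" "y \<in> carrier GL"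
  then show "x \<otimes>\<^bsub>GL\<^esub> y \<in> carrier GL"
    by (auto simp: GL_def invertible_mult)
next
  fix x :: "complex^'n^'n"
  assume "x \<in> carrier GL"
  then show "\<exists>y\<in>carrier GL. y \<otimes>\<^bsub>GL\<^esub> x = \<one>\<^bsub>GL\<^esub>"
    by (auto simp: GL_def invertible_def)
qed (auto simp: GL_def matrix_mul_assoc invertible_def)

lemma nat_pow_GL_subset: "A [^]\<^bsub>GL\<lparr>carrier := G\<rparr>\<^esub> (n :: nat) = matrix_power A n"
proof -
  have "operator_of (A [^]\<^bsub>GL\<lparr>carrier := G\<rparr>\<^esub> n) = operator_of A ^ n"
    by (induction n) (simp_all add: nat_pow_def GL_def operator_of_simps power_commutes)
  then show ?thesis
    by (simp add: matrix_eq_via_operator operator_of_matrix_power)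
qed

context
  fixes G :: "(complex^'n^'n) set"
  assumes Lie_group: "matrix_Lie_group G"
begin

lemma Lie_group_subgroup: "subgroup G GL"
  using Lie_group by (simp add: matrix_Lie_group_def)

lemma Lie_group_invertible: "A \<in> G \<Longrightarrow> invertible A"
  using subgroup.subset[OF Lie_group_subgroup] by (auto simp: GL_def)

lemma Lie_group_one: "mat 1 \<in> G"
  using subgroup.one_closed[OF Lie_group_subgroup] by (simp add: GL_def)

lemma Lie_group_mult: "A \<in> G \<Longrightarrow> B \<in> G \<Longrightarrow> A ** B \<in> G"
  using subgroup.m_closed[OF Lie_group_subgroup] by (simp add: GL_def)

lemma group_Lie_group: "group (GL\<lparr>carrier := G\<rparr>)"
  using group.subgroup_imp_group[OF group_GL Lie_group_subgroup] .

lemma inv_GL: "invertible A \<Longrightarrow> inv\<^bsub>GL\<^esub> A = matrix_inv (A :: complex^'n^'n)"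
proof (rule group.inv_equality[OF group_GL])
  assume A: "invertible A"
  then show "matrix_inv A \<otimes>\<^bsub>GL\<^esub> A = \<one>\<^bsub>GL\<^esub>" "A \<in> carrier GL" "matrix_inv A \<in> carrier GL"
    using matrix_inv_mult[OF A] by (auto simp: GL_def invertible_def)
qed

lemma inv_Lie_group: "A \<in> G \<Longrightarrow> inv\<^bsub>GL\<lparr>carrier := G\<rparr>\<^esub> A = matrix_inv A"
  using group.m_inv_consistent[OF group_GL Lie_group_subgroup] inv_GL Lie_group_invertible by metis

lemma Lie_group_matrix_inv: "A \<in> G \<Longrightarrow> matrix_inv A \<in> G"
  using subgroup.m_inv_closed[OF Lie_group_subgroup] inv_GL Lie_group_invertible by metis

lemma Lie_group_matrix_power: "A \<in> G \<Longrightarrow> matrix_power A n \<in> G"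
  by (induction n) (auto simp: Lie_group_one Lie_group_mult)

text \<open>The group is closed only relative to the invertible matrices, hence the hypothesis that the
  limit is invertible.\<close>
lemma Lie_group_limit:
  assumes "\<And>n. X n \<in> G" "X \<longlonglongrightarrow> A" "invertible A"
  shows "A \<in> G"
proof -
  obtain C where C: "closed C" "G = carrier GL \<inter> C"
    using Lie_group unfolding matrix_Lie_group_def closedin_closed by blast
  then have "A \<in> C"
    using assms closed_sequentially by blast
  then show ?thesis
    using C assms by (simp add: GL_def)
qed

lemma limitin_Lie_group_iff:
  "limitin (top_of_set G) X A sequentially \<longleftrightarrow>
    A \<in> G \<and> (\<forall>\<^sub>F n in sequentially. X n \<in> G) \<and> X \<longlonglongrightarrow> A"
  by (simp add: limitin_subtopology)

lemma matrix_exp_in_Lie_group: "X \<in> matrix_Lie_algebra G \<Longrightarrow> matrix_exp X \<in> G"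
  unfolding matrix_Lie_algebra_def by (metis (mono_tags) mem_Collect_eq scaleR_one)

text \<open>Closure under addition: the Lie product formula exhibits \<open>exp (t (X + Y))\<close> as a limit of
  elements of the closed group \<open>G\<close>.\<close>
lemma subspace_matrix_Lie_algebra: "subspace (matrix_Lie_algebra G)"
proof (rule subspaceI)
  fix X Y
  assume X: "X \<in> matrix_Lie_algebra G" and Y: "Y \<in> matrix_Lie_algebra G"
  have "matrix_exp (t *\<^sub>R (X + Y)) \<in> G" for t
  proof (rule Lie_group_limit[OF _ _ invertible_matrix_exp])
    let ?Z = "\<lambda>n. matrix_exp ((1 / real n) *\<^sub>R t *\<^sub>R X) ** matrix_exp ((1 / real n) *\<^sub>R t *\<^sub>R Y)"
    show "matrix_power (?Z n) n \<in> G" for n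
      using X Y by (intro Lie_group_matrix_power Lie_group_mult) (auto simp: matrix_Lie_algebra_def)
    show "(\<lambda>n. matrix_power (?Z n) n) \<longlonglongrightarrow> matrix_exp (t *\<^sub>R (X + Y))"
      unfolding scaleR_add_right by (intro matrix_exp_Lie_product_formula tendsto_const)
  qed
  then show "X + Y \<in> matrix_Lie_algebra G"
    by (simp add: matrix_Lie_algebra_def)
qed (auto simp: matrix_Lie_algebra_def Lie_group_one)

lemma matrix_Lie_algebra_conjugate:
  assumes "A \<in> G" "X \<in> matrix_Lie_algebra G"
  shows "matrix_exp (t *\<^sub>R (A ** X ** matrix_inv A)) = A ** matrix_exp (t *\<^sub>R X) ** matrix_inv A"
    and "A ** X ** matrix_inv A \<in> matrix_Lie_algebra G"
proof -
  show *: "matrix_exp (t *\<^sub>R (A ** X ** matrix_inv A)) = A ** matrix_exp (t *\<^sub>R X) ** matrix_inv A" for t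
    using matrix_exp_conjugate[OF Lie_group_invertible[OF assms(1)], of "t *\<^sub>R X"]
    by (simp only: matrix_scalar_ac scalar_matrix_assoc)
  show "A ** X ** matrix_inv A \<in> matrix_Lie_algebra G"
    using assms by (auto simp: matrix_Lie_algebra_def * intro!: Lie_group_mult Lie_group_matrix_inv)
qed

lemma topological_group_Lie_group: "topological_group (GL\<lparr>carrier := G\<rparr>) (top_of_set G)"
proof (intro topological_group.intro topological_group_axioms.intro)
  show "continuous_map (prod_topology (top_of_set G) (top_of_set G)) (top_of_set G)
      (\<lambda>(x, y). x \<otimes>\<^bsub>GL\<lparr>carrier := G\<rparr>\<^esub> y)"
    by (auto simp: GL_def case_prod_unfold Lie_group_mult
        intro!: continuous_on_matrix_mult continuous_intros)
  have "continuous_on G matrix_inv"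
    using continuous_on_subset[OF continuous_on_matrix_inv] Lie_group_invertible by blast
  then have "continuous_map (top_of_set G) (top_of_set G) matrix_inv"
    by (auto simp: Lie_group_matrix_inv)
  then show "continuous_map (top_of_set G) (top_of_set G) (\<lambda>x. inv\<^bsub>GL\<lparr>carrier := G\<rparr>\<^esub> x)"
    by (rule continuous_map_eq) (simp add: inv_Lie_group)
qed (simp_all add: group_Lie_group)

text \<open>Baire's theorem applies to \<open>G\<close>, a closed subset of an open subset of a complete space.\<close>
lemma completely_metrizable_Lie_group: "completely_metrizable_space (top_of_set G)"
proof -
  have "completely_metrizable_space (top_of_set (carrier (GL :: (complex^'n^'n) monoid)))"
    using completely_metrizable_space_openin[OF completely_metrizable_space_euclidean] open_invertible
    by (auto simp: GL_def)
  moreover have "closedin (top_of_set (carrier GL)) G"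
    using Lie_group by (simp add: matrix_Lie_group_def)
  ultimately have "completely_metrizable_space (subtopology (top_of_set (carrier GL)) G)"
    by (rule completely_metrizable_space_closedin)
  moreover have "G \<subseteq> carrier GL"
    using subgroup.subset[OF Lie_group_subgroup] .
  ultimately show ?thesis
    by (simp add: subtopology_subtopology inf_absorb2)
qed

text \<open>Left translations make \<open>G\<close> homogeneous.\<close>
lemma continuous_on_matrix_log:
  assumes bij: "bij_betw matrix_exp (matrix_Lie_algebra G) G"
  shows "continuous_on G (inv_into (matrix_Lie_algebra G) matrix_exp)"
proof (rule homogeneous_image_homeomorphism[OF subspace_matrix_Lie_algebra])
  show "continuous_on (matrix_Lie_algebra G) matrix_exp"
    by (simp add: continuous_on_def tendsto_matrix_exp)
  show "\<exists>\<phi>. continuous_on G \<phi> \<and> \<phi> \<in> G \<rightarrow> G \<and> inj_on \<phi> G \<and> \<phi> A = B"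
    if A: "A \<in> G" and B: "B \<in> G" for A B
  proof (intro exI conjI)
    let ?C = "B ** matrix_inv A"
    have C: "?C \<in> G"
      using A B by (intro Lie_group_mult Lie_group_matrix_inv)
    show "continuous_on G ((**) ?C)"
      by (intro continuous_on_matrix_mult continuous_intros)
    show "(**) ?C \<in> G \<rightarrow> G"
      using C Lie_group_mult by blast
    show "inj_on ((**) ?C) G"
    proof (rule inj_onI)
      fix X Y
      assume "?C ** X = ?C ** Y"
      then have "matrix_inv ?C ** ?C ** X = matrix_inv ?C ** ?C ** Y"
        by (simp flip: matrix_mul_assoc)
      then show "X = Y"
        by (simp add: matrix_inv_mult(2)[OF Lie_group_invertible[OF C]])
    qed
    show "?C ** A = B"
      by (simp add: matrix_inv_mult(2)[OF Lie_group_invertible[OF A]] flip: matrix_mul_assoc)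
  qed
qed (use bij completely_metrizable_Lie_group in \<open>auto simp: bij_betw_def\<close>)

lemma exponential_group_Lie_group:
  assumes bij: "bij_betw matrix_exp (matrix_Lie_algebra G) G"
  shows "exponential_group (GL\<lparr>carrier := G\<rparr>) (top_of_set G) matrix_exp (matrix_Lie_algebra G) (*\<^sub>R) (+)"
proof (intro exponential_group.intro exponential_group_axioms.intro topological_group_Lie_group)
  let ?V = "matrix_Lie_algebra G" and ?H = "GL\<lparr>carrier := G\<rparr>"
  note V = subspace_matrix_Lie_algebra
  have exp_V: "matrix_exp (t *\<^sub>R u) \<in> G" if "u \<in> ?V" for t u
    using that by (simp add: matrix_Lie_algebra_def)
  show "limitin (top_of_set G) (\<lambda>n. matrix_exp ((1 / real n) *\<^sub>R u)) \<one>\<^bsub>?H\<^esub> sequentially" if "u \<in> ?V" for u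
    using tendsto_matrix_exp[OF tendsto_scaleR[OF lim_1_over_n tendsto_const[of u]]] exp_V[OF that]
    by (simp add: limitin_Lie_group_iff Lie_group_one GL_def)
  fix u v us vs
  assume uv: "u \<in> ?V" "v \<in> ?V" "\<And>n. us n \<in> ?V" "\<And>n. vs n \<in> ?V"
    and lim: "limitin (top_of_set G) (\<lambda>n. matrix_exp (us n)) (matrix_exp u) sequentially"
      "limitin (top_of_set G) (\<lambda>n. matrix_exp (vs n)) (matrix_exp v) sequentially"
  have log: "ws \<longlonglongrightarrow> w"
    if "w \<in> ?V" "\<And>n. ws n \<in> ?V" "limitin (top_of_set G) (\<lambda>n. matrix_exp (ws n)) (matrix_exp w) sequentially"
    for ws w
    using continuous_on_tendsto_compose[OF continuous_on_matrix_log[OF bij], of "\<lambda>n. matrix_exp (ws n)" "matrix_exp w"] that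
    by (simp add: limitin_Lie_group_iff bij_betw_inv_into_left[OF bij])
  have "(\<lambda>n. matrix_power (matrix_exp ((1 / real n) *\<^sub>R us n) ** matrix_exp ((1 / real n) *\<^sub>R vs n)) n)
      \<longlonglongrightarrow> matrix_exp (u + v)"
    using uv lim by (intro matrix_exp_Lie_product_formula log)
  moreover have "matrix_power (matrix_exp ((1 / real n) *\<^sub>R us n) ** matrix_exp ((1 / real n) *\<^sub>R vs n)) n \<in> G" for n
    using uv by (intro Lie_group_matrix_power Lie_group_mult exp_V)
  ultimately show "limitin (top_of_set G)
      (\<lambda>n. (matrix_exp ((1 / real n) *\<^sub>R us n) \<otimes>\<^bsub>?H\<^esub> matrix_exp ((1 / real n) *\<^sub>R vs n)) [^]\<^bsub>?H\<^esub> n)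
      (matrix_exp (u + v)) sequentially"
    using uv matrix_exp_in_Lie_group[OF subspace_add[OF V]]
    by (simp add: limitin_Lie_group_iff nat_pow_GL_subset) (simp add: GL_def)
qed (use bij subspace_matrix_Lie_algebra in
    \<open>auto simp: subspace_scale subspace_add matrix_exp_add_multiples GL_def Hausdorff_space_subtopology\<close>)

lemma limit_weight_zero_Rota_Baxter_Lie_group_iff:
  assumes bij: "bij_betw matrix_exp (matrix_Lie_algebra G) G" and B: "B \<in> G \<rightarrow> G"
  shows "limit_weight_zero_Rota_Baxter (GL\<lparr>carrier := G\<rparr>) (top_of_set G) B \<longleftrightarrow>
    (\<forall>u \<in> matrix_Lie_algebra G. \<forall>v \<in> matrix_Lie_algebra G.
       B (matrix_exp u) ** B (matrix_exp v) =
       B (matrix_exp (u + B (matrix_exp u) ** v ** matrix_inv (B (matrix_exp u)))))"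
proof -
  interpret exponential_group "GL\<lparr>carrier := G\<rparr>" "top_of_set G" matrix_exp "matrix_Lie_algebra G"
    "(*\<^sub>R)" "(+)"
    by (rule exponential_group_Lie_group[OF bij])
  have "limit_weight_zero_Rota_Baxter (GL\<lparr>carrier := G\<rparr>) (top_of_set G) B \<longleftrightarrow>
    (\<forall>u \<in> matrix_Lie_algebra G. \<forall>v \<in> matrix_Lie_algebra G.
       B (matrix_exp u) \<otimes>\<^bsub>GL\<lparr>carrier := G\<rparr>\<^esub> B (matrix_exp v) =
       B (matrix_exp (u + B (matrix_exp u) ** v ** matrix_inv (B (matrix_exp u)))))"
    by (rule limit_weight_zero_Rota_Baxter_iff)
      (use B matrix_Lie_algebra_conjugate in \<open>auto simp: inv_Lie_group\<close>, simp_all add: GL_def)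
  then show ?thesis
    by (simp add: GL_def)
qed

end

section \<open>Smooth maps\<close>

text \<open>Any class of functions that contains with each function some derivative of it consists of
  smooth functions, by iterating the choice of a derivative. For products this replaces Leibniz'
  formula for the higher derivatives.\<close>
lemma smooth_coinduct:
  assumes "P f"
    and step: "\<And>f. P f \<Longrightarrow> \<exists>f'. P f' \<and> (\<forall>t. (f has_vector_derivative f' t) (at t))"
  shows "smooth f"
proof -
  define F where "F f = (SOME f'. P f' \<and> (\<forall>t. (f has_vector_derivative f' t) (at t)))" for f
  have F: "P (F f)" "(f has_vector_derivative F f t) (at t)" if "P f" for f t
    using someI_ex[OF step[OF that]] unfolding F_def by auto
  have "P ((F ^^ k) f)" for k
    by (induction k) (auto simp: \<open>P f\<close> F)
  then show ?thesis
    unfolding smooth_def by (intro exI[of _ "\<lambda>k. (F ^^ k) f"]) (auto intro: F)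
qed

lemma smooth_has_smooth_derivative:
  assumes "smooth f"
  shows "\<exists>f'. smooth f' \<and> (\<forall>t. (f has_vector_derivative f' t) (at t))"
proof -
  obtain D where D: "D 0 = f" "\<And>k t. (D k has_vector_derivative D (Suc k) t) (at t)"
    using assms unfolding smooth_def by blast
  then have "smooth (D 1)"
    unfolding smooth_def by (intro exI[of _ "\<lambda>k. D (Suc k)"]) auto
  then show ?thesis
    using D(2)[of 0] D(1) by (intro exI[of _ "D 1"]) auto
qed

lemma smooth_const: "smooth (\<lambda>t. c)"
  by (rule smooth_coinduct[where P = "\<lambda>f. \<exists>c. f = (\<lambda>t. c)"])
    (auto intro: has_vector_derivative_const)

lemma smooth_add:
  assumes "smooth f" "smooth g"
  shows "smooth (\<lambda>t. f t + g t)"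
proof (rule smooth_coinduct[where P = "\<lambda>h. \<exists>f g. smooth f \<and> smooth g \<and> h = (\<lambda>t. f t + g t)"])
  fix h :: "real \<Rightarrow> 'a"
  assume "\<exists>f g. smooth f \<and> smooth g \<and> h = (\<lambda>t. f t + g t)"
  then obtain f g where h: "h = (\<lambda>t. f t + g t)" and fg: "smooth f" "smooth g"
    by blast
  obtain f' g' where "smooth f'" "smooth g'"
    "\<And>t. (f has_vector_derivative f' t) (at t)" "\<And>t. (g has_vector_derivative g' t) (at t)"
    using fg[THEN smooth_has_smooth_derivative] by blast
  with h show "\<exists>h'. (\<exists>f g. smooth f \<and> smooth g \<and> h' = (\<lambda>t. f t + g t)) \<and>
      (\<forall>t. (h has_vector_derivative h' t) (at t))"
    by (intro exI[of _ "\<lambda>t. f' t + g' t"]) (auto intro: has_vector_derivative_add)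
qed (use assms in blast)

lemma smooth_bounded_linear:
  assumes L: "bounded_linear L" and "smooth f"
  shows "smooth (\<lambda>t. L (f t))"
proof (rule smooth_coinduct[where P = "\<lambda>h. \<exists>f. smooth f \<and> h = (\<lambda>t. L (f t))"])
  fix h
  assume "\<exists>f. smooth f \<and> h = (\<lambda>t. L (f t))"
  then obtain f where h: "h = (\<lambda>t. L (f t))" and f: "smooth f"
    by blast
  obtain f' where "smooth f'" "\<And>t. (f has_vector_derivative f' t) (at t)"
    using smooth_has_smooth_derivative[OF f] by blast
  with h show "\<exists>h'. (\<exists>f. smooth f \<and> h' = (\<lambda>t. L (f t))) \<and> (\<forall>t. (h has_vector_derivative h' t) (at t))"
    by (intro exI[of _ "\<lambda>t. L (f' t)"]) (auto intro: bounded_linear.has_vector_derivative[OF L])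
qed (use assms in blast)

text \<open>Products of smooth functions are not closed under differentiation, but finite sums of such
  products are.\<close>
inductive sum_of_smooth_products ::
  "('a::real_normed_vector \<Rightarrow> 'b::real_normed_vector \<Rightarrow> 'c::real_normed_vector) \<Rightarrow> (real \<Rightarrow> 'c) \<Rightarrow> bool"
  for mul where
  product: "smooth f \<Longrightarrow> smooth g \<Longrightarrow> sum_of_smooth_products mul (\<lambda>t. mul (f t) (g t))"
| sum: "sum_of_smooth_products mul h \<Longrightarrow> sum_of_smooth_products mul k \<Longrightarrow>
    sum_of_smooth_products mul (\<lambda>t. h t + k t)"

lemma smooth_bounded_bilinear:
  assumes bilinear: "bounded_bilinear mul" and fg: "smooth f" "smooth g"
  shows "smooth (\<lambda>t. mul (f t) (g t))"
proof (rule smooth_coinduct[where P = "sum_of_smooth_products mul"])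
  show "\<exists>h'. sum_of_smooth_products mul h' \<and> (\<forall>t. (h has_vector_derivative h' t) (at t))"
    if "sum_of_smooth_products mul h" for h
    using that
  proof induction
    case (product f g)
    then obtain f' g' where D: "smooth f'" "smooth g'"
      "\<And>t. (f has_vector_derivative f' t) (at t)" "\<And>t. (g has_vector_derivative g' t) (at t)"
      using product[THEN smooth_has_smooth_derivative] by blast
    then have "((\<lambda>t. mul (f t) (g t)) has_vector_derivative mul (f t) (g' t) + mul (f' t) (g t)) (at t)" for t
      by (intro bounded_bilinear.has_vector_derivative[OF bilinear])
    moreover have "sum_of_smooth_products mul (\<lambda>t. mul (f t) (g' t) + mul (f' t) (g t))"
      using product D by (intro sum_of_smooth_products.intros)
    ultimately show ?case
      by blast
  next
    case (sum h k)
    then obtain h' k' where "sum_of_smooth_products mul h'" "sum_of_smooth_products mul k'"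
      "\<And>t. (h has_vector_derivative h' t) (at t)" "\<And>t. (k has_vector_derivative k' t) (at t)"
      by blast
    then show ?case
      by (intro exI[of _ "\<lambda>t. h' t + k' t"])
        (auto intro: has_vector_derivative_add sum_of_smooth_products.sum)
  qed
qed (use fg in \<open>auto intro: sum_of_smooth_products.product\<close>)

lemmas smooth_matrix_mult = smooth_bounded_bilinear[OF bounded_bilinear_matrix_mult]

lemmas smooth_scaleR = smooth_bounded_linear[OF bounded_linear_scaleR_right]

section \<open>Strictly upper triangular matrices of size three\<close>

abbreviation "\<N> \<equiv> strictly_upper_triangular"

lemmas matrix_3_simps =
  vec_eq_iff forall_3 matrix_matrix_mult_def sum_3 mat_def

lemma strictly_upper_triangular_closed:
  shows "A \<in> \<N> \<Longrightarrow> B \<in> \<N> \<Longrightarrow> A + B \<in> \<N>"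
    and "A \<in> \<N> \<Longrightarrow> r *\<^sub>R A \<in> \<N>"
    and "A \<in> \<N> \<Longrightarrow> B \<in> \<N> \<Longrightarrow> A ** B \<in> \<N>"
  by (auto simp: strictly_upper_triangular_def matrix_matrix_mult_def sum_3)

lemma strictly_upper_triangular_product_3:
  assumes "A \<in> \<N>" "B \<in> \<N>" "C \<in> \<N>"
  shows "A ** (B ** C) = 0"
  using assms by (simp add: strictly_upper_triangular_def matrix_3_simps)

lemma matrix_exp_strictly_upper_triangular:
  assumes "A \<in> \<N>"
  shows "matrix_exp A = mat 1 + A + (1 / 2) *\<^sub>R (A ** A)"
proof -
  have vanish: "matrix_power A (Suc (Suc (Suc k))) = 0" for k
    using strictly_upper_triangular_product_3[OF assms assms assms]
    by (induction k) simp_all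
  have "matrix_power A k = 0" if "k \<notin> {..<3}" for k
  proof -
    obtain j where "k = 3 + j"
      using \<open>k \<notin> {..<3}\<close> le_Suc_ex by (metis lessThan_iff not_less)
    then show ?thesis
      using vanish[of j] by (simp add: numeral_3_eq_3)
  qed
  then have "matrix_exp A = (\<Sum>k<3. (1 / fact k) *\<^sub>R matrix_power A k)"
    unfolding matrix_exp_def by (intro suminf_finite) auto
  then show ?thesis
    by (simp add: numeral_3_eq_3 numeral_2_eq_2)
qed

text \<open>All products of three factors vanish, so the Baker-Campbell-Hausdorff series ends after the
  first commutator. It shows that exponentials of smooth maps are closed under multiplication.\<close>
lemma Baker_Campbell_Hausdorff_strictly_upper_triangular:
  assumes "A \<in> \<N>" "B \<in> \<N>"
  shows "matrix_exp A ** matrix_exp B = matrix_exp (A + B + (1 / 2) *\<^sub>R (A ** B) + (- 1 / 2) *\<^sub>R (B ** A))"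
proof -
  have C: "A + B + (1 / 2) *\<^sub>R (A ** B) + (- 1 / 2) *\<^sub>R (B ** A) \<in> \<N>"
    using assms by (intro strictly_upper_triangular_closed)
  show ?thesis
    unfolding matrix_exp_strictly_upper_triangular[OF C] matrix_exp_strictly_upper_triangular[OF assms(1)]
      matrix_exp_strictly_upper_triangular[OF assms(2)]
    using assms
    by (simp add: strictly_upper_triangular_def matrix_3_simps)
      (simp add: scaleR_conv_of_real field_simps)
qed

text \<open>The series \<open>log (1 + N) = N - N\<^sup>2/2 + \<dots>\<close>, broken off because \<open>N\<^sup>3 = 0\<close>. Being a
  polynomial it is continuous on all matrices.\<close>
definition unipotent_log :: "complex^3^3 \<Rightarrow> complex^3^3" where
  "unipotent_log M = (M - mat 1) + (- 1 / 2) *\<^sub>R ((M - mat 1) ** (M - mat 1))"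

lemma unipotent_log_matrix_exp:
  assumes "A \<in> \<N>"
  shows "unipotent_log (matrix_exp A) = A"
  unfolding unipotent_log_def matrix_exp_strictly_upper_triangular[OF assms]
  using assms by (simp add: strictly_upper_triangular_def matrix_3_simps)

lemma tendsto_unipotent_log:
  "(f \<longlongrightarrow> M) F \<Longrightarrow> ((\<lambda>x. unipotent_log (f x)) \<longlongrightarrow> unipotent_log M) F"
  unfolding unipotent_log_def by (intro tendsto_intros tendsto_matrix_mult)

text \<open>Since \<open>A B A = 0\<close> and all other products of three factors vanish as well, the conjugate
  is \<open>B + A B - B A\<close>.\<close>
lemma strictly_upper_triangular_conjugate:
  assumes A: "A \<in> \<N>" and B: "B \<in> \<N>"
  shows "matrix_exp A ** B ** matrix_inv (matrix_exp A) \<in> \<N>"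
proof -
  have "- A \<in> \<N>"
    using strictly_upper_triangular_closed(2)[OF A, of "-1"] by simp
  moreover have "matrix_inv (matrix_exp A) = matrix_exp (- A)"
    by (rule matrix_inv_unique[OF matrix_exp_minus])
  ultimately show ?thesis
    using A B
    by (simp add: matrix_exp_strictly_upper_triangular)
      (simp add: strictly_upper_triangular_def matrix_3_simps)
qed

section \<open>The group of exponentials of smooth maps\<close>

lemma J_maps_closed:
  shows "u \<in> J_maps \<Longrightarrow> v \<in> J_maps \<Longrightarrow> (\<lambda>x. u x + v x) \<in> J_maps"
    and "u \<in> J_maps \<Longrightarrow> (\<lambda>x. r *\<^sub>R u x) \<in> J_maps"
    and "u \<in> J_maps \<Longrightarrow> v \<in> J_maps \<Longrightarrow> (\<lambda>x. u x ** v x) \<in> J_maps"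
  using strictly_upper_triangular_closed
  by (auto simp: J_maps_def image_subset_iff smooth_add smooth_scaleR smooth_matrix_mult)

lemma J_maps_zero: "(\<lambda>x. 0) \<in> J_maps"
  using smooth_const by (auto simp: J_maps_def strictly_upper_triangular_def)

lemma J_maps_strictly_upper_triangular: "u \<in> J_maps \<Longrightarrow> u x \<in> \<N>"
  by (auto simp: J_maps_def image_subset_iff)

lemma smooth_pointwise_exp:
  assumes u: "u \<in> J_maps"
  shows "smooth (pointwise_exp u)"
proof -
  have "smooth u"
    using u by (simp add: J_maps_def)
  then have "smooth (\<lambda>x. mat 1 + u x + (1 / 2) *\<^sub>R (u x ** u x))"
    by (intro smooth_add smooth_scaleR smooth_matrix_mult smooth_const)
  then show ?thesis
    unfolding pointwise_exp_def
    using matrix_exp_strictly_upper_triangular[OF J_maps_strictly_upper_triangular[OF u]] by simp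
qed

lemma J_maps_uminus: "u \<in> J_maps \<Longrightarrow> (\<lambda>x. - u x) \<in> J_maps"
  using J_maps_closed(2)[of u "-1"] by simp

lemma exp_J_simps:
  "carrier exp_J = pointwise_exp ` J_maps" "f \<otimes>\<^bsub>exp_J\<^esub> g = (\<lambda>x. f x ** g x)"
  "\<one>\<^bsub>exp_J\<^esub> = (\<lambda>x. mat 1)"
  by (simp_all add: exp_J_def)

lemma group_exp_J: "group exp_J"
proof (rule groupI)
  fix f g h
  assume f: "f \<in> carrier exp_J"
  then obtain u where u: "u \<in> J_maps" "f = pointwise_exp u"
    by (auto simp: exp_J_simps)
  show "\<exists>k\<in>carrier exp_J. k \<otimes>\<^bsub>exp_J\<^esub> f = \<one>\<^bsub>exp_J\<^esub>"
  proof
    show "pointwise_exp (\<lambda>x. - u x) \<in> carrier exp_J"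
      using J_maps_uminus[OF u(1)] by (simp add: exp_J_simps)
    show "pointwise_exp (\<lambda>x. - u x) \<otimes>\<^bsub>exp_J\<^esub> f = \<one>\<^bsub>exp_J\<^esub>"
      by (simp add: exp_J_simps u pointwise_exp_def matrix_exp_minus)
  qed
  show "\<one>\<^bsub>exp_J\<^esub> \<otimes>\<^bsub>exp_J\<^esub> f = f"
    by (simp add: exp_J_simps)
  show "f \<otimes>\<^bsub>exp_J\<^esub> g \<otimes>\<^bsub>exp_J\<^esub> h = f \<otimes>\<^bsub>exp_J\<^esub> (g \<otimes>\<^bsub>exp_J\<^esub> h)"
    by (simp add: exp_J_simps matrix_mul_assoc)
  assume "g \<in> carrier exp_J"
  then obtain v where v: "v \<in> J_maps" "g = pointwise_exp v"
    by (auto simp: exp_J_simps)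
  let ?w = "\<lambda>x. u x + v x + (1 / 2) *\<^sub>R (u x ** v x) + (- 1 / 2) *\<^sub>R (v x ** u x)"
  have "f \<otimes>\<^bsub>exp_J\<^esub> g = pointwise_exp ?w"
    using Baker_Campbell_Hausdorff_strictly_upper_triangular u v J_maps_strictly_upper_triangular
    by (simp add: exp_J_simps pointwise_exp_def)
  moreover have "?w \<in> J_maps"
    using u v by (intro J_maps_closed)
  ultimately show "f \<otimes>\<^bsub>exp_J\<^esub> g \<in> carrier exp_J"
    by (auto simp: exp_J_simps)
next
  have "\<one>\<^bsub>exp_J\<^esub> = pointwise_exp (\<lambda>x. 0)"
    by (simp add: exp_J_simps pointwise_exp_def)
  then show "\<one>\<^bsub>exp_J\<^esub> \<in> carrier exp_J"
    using J_maps_zero by (simp only: exp_J_simps(1) imageI)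
qed

lemma exp_J_invertible: "f \<in> carrier exp_J \<Longrightarrow> invertible (f x)"
  by (auto simp: exp_J_simps pointwise_exp_def invertible_matrix_exp)

lemma inv_exp_J:
  assumes "f \<in> carrier exp_J"
  shows "inv\<^bsub>exp_J\<^esub> f = (\<lambda>x. matrix_inv (f x))"
proof -
  have "(inv\<^bsub>exp_J\<^esub> f) x ** f x = mat 1" "f x ** (inv\<^bsub>exp_J\<^esub> f) x = mat 1" for x
    using group.l_inv[OF group_exp_J assms] group.r_inv[OF group_exp_J assms]
    by (auto simp: exp_J_simps fun_eq_iff)
  then show ?thesis
    using matrix_inv_unique by metis
qed

lemma nat_pow_exp_J: "(f [^]\<^bsub>exp_J\<^esub> (n :: nat)) x = matrix_power (f x) n"
proof -
  have "operator_of ((f [^]\<^bsub>exp_J\<^esub> n) x) = operator_of (f x) ^ n"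
    by (induction n) (simp_all add: nat_pow_def exp_J_simps operator_of_simps power_commutes)
  then show ?thesis
    by (simp add: matrix_eq_via_operator operator_of_matrix_power)
qed

lemma topspace_pointwise_topology: "topspace pointwise_topology = carrier exp_J"
  by (simp add: pointwise_topology_def)

lemma Hausdorff_pointwise_topology: "Hausdorff_space pointwise_topology"
  unfolding pointwise_topology_def
  by (intro Hausdorff_space_subtopology) (simp add: Hausdorff_space_product_topology)

lemma limitin_pointwise_topology_iff:
  "limitin pointwise_topology X f sequentially \<longleftrightarrow>
    f \<in> carrier exp_J \<and> (\<forall>\<^sub>F n in sequentially. X n \<in> carrier exp_J) \<and> (\<forall>x. (\<lambda>n. X n x) \<longlonglongrightarrow> f x)"
  by (simp add: pointwise_topology_def limitin_subtopology limitin_componentwise)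

lemma continuous_map_evaluation: "continuous_map pointwise_topology euclidean (\<lambda>f. f x)"
  unfolding pointwise_topology_def
  by (intro continuous_map_from_subtopology continuous_map_product_projection) simp

lemma continuous_map_into_pointwise_topology:
  assumes "\<And>x. continuous_map S euclidean (\<lambda>s. F s x)" "\<And>s. s \<in> topspace S \<Longrightarrow> F s \<in> carrier exp_J"
  shows "continuous_map S pointwise_topology F"
  using assms
  by (auto simp: pointwise_topology_def continuous_map_in_subtopology continuous_map_componentwise_UNIV)

lemma topological_group_exp_J: "topological_group exp_J pointwise_topology"
proof (intro topological_group.intro topological_group_axioms.intro group_exp_J
    topspace_pointwise_topology)
  interpret group exp_J
    by (rule group_exp_J)
  let ?T = pointwise_topology
  show "continuous_map (prod_topology ?T ?T) ?T (\<lambda>(f, g). f \<otimes>\<^bsub>exp_J\<^esub> g)"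
  proof (rule continuous_map_into_pointwise_topology)
    fix x :: real
    have "continuous_map (prod_topology ?T ?T) euclidean (\<lambda>p. fst p x)"
      "continuous_map (prod_topology ?T ?T) euclidean (\<lambda>p. snd p x)"
      using continuous_map_compose[OF continuous_map_fst continuous_map_evaluation]
        continuous_map_compose[OF continuous_map_snd continuous_map_evaluation] by (auto simp: o_def)
    then have "continuous_map (prod_topology ?T ?T) euclidean (\<lambda>p. fst p x ** snd p x)"
      by (simp add: continuous_map_atin tendsto_matrix_mult)
    then show "continuous_map (prod_topology ?T ?T) euclidean (\<lambda>p. (case p of (f, g) \<Rightarrow> f \<otimes>\<^bsub>exp_J\<^esub> g) x)"
      by (simp add: case_prod_unfold exp_J_simps)
  qed (auto simp: topspace_pointwise_topology)
  show "continuous_map ?T ?T (\<lambda>f. inv\<^bsub>exp_J\<^esub> f)"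
  proof (rule continuous_map_into_pointwise_topology)
    fix x :: real
    have "continuous_map ?T (top_of_set {A. invertible A}) (\<lambda>f. f x)"
      using continuous_map_evaluation exp_J_invertible
      by (auto simp: continuous_map_in_subtopology topspace_pointwise_topology)
    moreover have "continuous_map (top_of_set {A :: complex^3^3. invertible A}) euclidean matrix_inv"
      by (simp add: continuous_on_matrix_inv)
    ultimately have "continuous_map ?T euclidean (matrix_inv \<circ> (\<lambda>f. f x))"
      by (rule continuous_map_compose)
    then have "continuous_map ?T euclidean (\<lambda>f. matrix_inv (f x))"
      by (simp only: o_def)
    then show "continuous_map ?T euclidean (\<lambda>f. (inv\<^bsub>exp_J\<^esub> f) x)"
      by (rule continuous_map_eq) (simp add: topspace_pointwise_topology inv_exp_J)
  qed (auto simp: topspace_pointwise_topology)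
qed

lemma bij_betw_pointwise_exp: "bij_betw pointwise_exp J_maps (carrier exp_J)"
proof -
  have "inj_on pointwise_exp J_maps"
  proof (rule inj_onI)
    fix u v
    assume "u \<in> J_maps" "v \<in> J_maps" "pointwise_exp u = pointwise_exp v"
    then show "u = v"
      unfolding pointwise_exp_def fun_eq_iff
      by (metis unipotent_log_matrix_exp J_maps_strictly_upper_triangular)
  qed
  then show ?thesis
    by (simp add: bij_betw_def exp_J_simps)
qed

text \<open>In the topology of pointwise convergence all limits are taken at one real number at a time,
  where the facts on matrices apply.\<close>
lemma exponential_group_exp_J:
  "exponential_group exp_J pointwise_topology pointwise_exp J_maps (\<lambda>t u x. t *\<^sub>R u x) (\<lambda>u v x. u x + v x)"
proof (intro exponential_group.intro exponential_group_axioms.intro topological_group_exp_J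
    Hausdorff_pointwise_topology bij_betw_pointwise_exp)
  interpret group exp_J
    by (rule group_exp_J)
  have exp_closed: "pointwise_exp (\<lambda>x. t *\<^sub>R u x) \<in> carrier exp_J" if "u \<in> J_maps" for t u
    using J_maps_closed(2)[OF that] by (simp add: exp_J_simps)
  show "limitin pointwise_topology (\<lambda>n. pointwise_exp (\<lambda>x. (1 / real n) *\<^sub>R u x)) \<one>\<^bsub>exp_J\<^esub> sequentially"
    if "u \<in> J_maps" for u
    using tendsto_matrix_exp[OF tendsto_scaleR[OF lim_1_over_n tendsto_const]] exp_closed[OF that]
      one_closed[unfolded exp_J_simps(3)]
    by (auto simp: limitin_pointwise_topology_iff exp_J_simps(3) pointwise_exp_def)
  fix u v us vs
  assume uv: "u \<in> J_maps" "v \<in> J_maps" "\<And>n. us n \<in> J_maps" "\<And>n. vs n \<in> J_maps"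
    and lim: "limitin pointwise_topology (\<lambda>n. pointwise_exp (us n)) (pointwise_exp u) sequentially"
      "limitin pointwise_topology (\<lambda>n. pointwise_exp (vs n)) (pointwise_exp v) sequentially"
  have log: "(\<lambda>n. ws n x) \<longlonglongrightarrow> w x"
    if "w \<in> J_maps" "\<And>n. ws n \<in> J_maps"
      "limitin pointwise_topology (\<lambda>n. pointwise_exp (ws n)) (pointwise_exp w) sequentially" for ws w x
  proof -
    have "(\<lambda>n. unipotent_log (matrix_exp (ws n x))) \<longlonglongrightarrow> unipotent_log (matrix_exp (w x))"
      using that by (intro tendsto_unipotent_log) (simp add: limitin_pointwise_topology_iff pointwise_exp_def)
    then show ?thesis
      using that by (simp add: unipotent_log_matrix_exp J_maps_strictly_upper_triangular)
  qed
  let ?P = "\<lambda>n. pointwise_exp (\<lambda>x. (1 / real n) *\<^sub>R us n x) \<otimes>\<^bsub>exp_J\<^esub> pointwise_exp (\<lambda>x. (1 / real n) *\<^sub>R vs n x)"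
  have "(\<lambda>n. (?P n [^]\<^bsub>exp_J\<^esub> n) x) \<longlonglongrightarrow> pointwise_exp (\<lambda>x. u x + v x) x" for x
    using matrix_exp_Lie_product_formula[OF log log, OF uv(1,3) lim(1) uv(2,4) lim(2), of x x]
    by (simp add: nat_pow_exp_J exp_J_simps pointwise_exp_def)
  moreover have "?P n [^]\<^bsub>exp_J\<^esub> n \<in> carrier exp_J" for n
    using uv by (intro nat_pow_closed m_closed exp_closed)
  moreover have "pointwise_exp (\<lambda>x. u x + v x) \<in> carrier exp_J"
    using J_maps_closed(1)[OF uv(1,2)] by (simp add: exp_J_simps)
  ultimately show "limitin pointwise_topology (\<lambda>n. ?P n [^]\<^bsub>exp_J\<^esub> n) (pointwise_exp (\<lambda>x. u x + v x)) sequentially"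
    by (simp add: limitin_pointwise_topology_iff)
qed (auto simp: J_maps_closed exp_J_simps pointwise_exp_def matrix_exp_add_multiples)

text \<open>The inverse of \<open>exp u\<close> is \<open>exp (- u)\<close>, which is smooth because it is a polynomial
  in \<open>u\<close>.\<close>
lemma J_maps_conjugate:
  assumes f: "f \<in> carrier exp_J" and v: "v \<in> J_maps"
  shows "(\<lambda>x. f x ** v x ** matrix_inv (f x)) \<in> J_maps"
proof -
  obtain u where u: "u \<in> J_maps" "f = pointwise_exp u"
    using f by (auto simp: exp_J_simps)
  have inverse: "matrix_inv (f x) = pointwise_exp (\<lambda>x. - u x) x" for x
    by (simp add: u pointwise_exp_def matrix_inv_unique matrix_exp_minus)
  have "smooth v"
    using v by (simp add: J_maps_def)
  then have "smooth (\<lambda>x. pointwise_exp u x ** v x ** pointwise_exp (\<lambda>x. - u x) x)"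
    using smooth_pointwise_exp[OF u(1)] smooth_pointwise_exp[OF J_maps_uminus[OF u(1)]]
    by (intro smooth_matrix_mult)
  then have "smooth (\<lambda>x. f x ** v x ** matrix_inv (f x))"
    unfolding inverse by (simp only: u(2))
  moreover have "f x ** v x ** matrix_inv (f x) \<in> \<N>" for x
    using strictly_upper_triangular_conjugate u v J_maps_strictly_upper_triangular
    by (simp add: pointwise_exp_def)
  ultimately show ?thesis
    by (auto simp: J_maps_def)
qed

lemma limit_weight_zero_Rota_Baxter_exp_J_iff:
  assumes B: "B \<in> carrier exp_J \<rightarrow> carrier exp_J"
  shows "limit_weight_zero_Rota_Baxter exp_J pointwise_topology B \<longleftrightarrow>
    (\<forall>u \<in> J_maps. \<forall>v \<in> J_maps.
       (\<lambda>x. B (pointwise_exp u) x ** B (pointwise_exp v) x) =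
       B (pointwise_exp
            (\<lambda>x. u x + B (pointwise_exp u) x ** v x ** matrix_inv (B (pointwise_exp u) x))))"
proof -
  interpret exponential_group exp_J pointwise_topology pointwise_exp J_maps
    "\<lambda>t u x. t *\<^sub>R u x" "\<lambda>u v x. u x + v x"
    by (rule exponential_group_exp_J)
  have "limit_weight_zero_Rota_Baxter exp_J pointwise_topology B \<longleftrightarrow>
    (\<forall>u \<in> J_maps. \<forall>v \<in> J_maps.
       B (pointwise_exp u) \<otimes>\<^bsub>exp_J\<^esub> B (pointwise_exp v) =
       B (pointwise_exp
            (\<lambda>x. u x + B (pointwise_exp u) x ** v x ** matrix_inv (B (pointwise_exp u) x))))"
  proof (rule limit_weight_zero_Rota_Baxter_iff[OF B])
    fix f v t
    assume fv: "f \<in> carrier exp_J" "v \<in> J_maps"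
    then show "(\<lambda>x. f x ** v x ** matrix_inv (f x)) \<in> J_maps"
      by (rule J_maps_conjugate)
    show "pointwise_exp (\<lambda>x. t *\<^sub>R (f x ** v x ** matrix_inv (f x)))
        = f \<otimes>\<^bsub>exp_J\<^esub> pointwise_exp (\<lambda>x. t *\<^sub>R v x) \<otimes>\<^bsub>exp_J\<^esub> inv\<^bsub>exp_J\<^esub> f"
    proof
      fix x
      show "pointwise_exp (\<lambda>x. t *\<^sub>R (f x ** v x ** matrix_inv (f x))) x
        = (f \<otimes>\<^bsub>exp_J\<^esub> pointwise_exp (\<lambda>x. t *\<^sub>R v x) \<otimes>\<^bsub>exp_J\<^esub> inv\<^bsub>exp_J\<^esub> f) x"
        unfolding inv_exp_J[OF fv(1)] exp_J_simps pointwise_exp_def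
        using matrix_exp_conjugate[OF exp_J_invertible[OF fv(1)], of x "t *\<^sub>R v x"]
        by (simp only: matrix_scalar_ac scalar_matrix_assoc)
    qed
  qed
  then show ?thesis
    by (simp add: exp_J_simps)
qed

section \<open>The characterization\<close>

theorem theorem3p14:
  fixes G :: "(complex^'n^'n) set"
    and B :: "complex^'n^'n \<Rightarrow> complex^'n^'n"
    and BJ :: "(real \<Rightarrow> complex^3^3) \<Rightarrow> (real \<Rightarrow> complex^3^3)"
  shows
    "(matrix_Lie_group G \<and> bij_betw matrix_exp (matrix_Lie_algebra G) G \<and> B \<in> G \<rightarrow> G \<longrightarrow>
        (limit_weight_zero_Rota_Baxter (GL\<lparr>carrier := G\<rparr>) (top_of_set G) B \<longleftrightarrow>
          (\<forall>u \<in> matrix_Lie_algebra G. \<forall>v \<in> matrix_Lie_algebra G.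
             B (matrix_exp u) ** B (matrix_exp v) =
             B (matrix_exp (u + B (matrix_exp u) ** v ** matrix_inv (B (matrix_exp u))))))) \<and>
     (BJ \<in> carrier exp_J \<rightarrow> carrier exp_J \<longrightarrow>
        (limit_weight_zero_Rota_Baxter exp_J pointwise_topology BJ \<longleftrightarrow>
          (\<forall>u \<in> J_maps. \<forall>v \<in> J_maps.
             (\<lambda>x. BJ (pointwise_exp u) x ** BJ (pointwise_exp v) x) =
             BJ (pointwise_exp
                  (\<lambda>x. u x + BJ (pointwise_exp u) x ** v x ** matrix_inv (BJ (pointwise_exp u) x))))))"
  by (intro conjI impI; (elim conjE)?)
    (rule limit_weight_zero_Rota_Baxter_Lie_group_iff limit_weight_zero_Rota_Baxter_exp_J_iff; assumption)+

end
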